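(* Let $\Gamma=\mathbb{Z}^2\rtimes\mathbb{Z}$, where $\mathbb{Z}$ acts by powers of $A=\begin{pmatrix}1&1\\1&0\end{pmatrix}$, embedded in $GL_3(\mathbb{Z})$ by $(v,k)\mapsto\begin{pmatrix}A^k&v\\0&1\end{pmatrix}$. For $N>0$ let $\Gamma(N)=\Gamma\cap\ker(GL_3(\mathbb{Z})\to GL_3(\mathbb{Z}/N\mathbb{Z}))$. A congruence box space of $\Gamma$ is a box space $\square_{(\Gamma(N_k))}\Gamma$, where $(N_k)_{k>0}$ is an increasing sequence of positive integers with $N_k$ dividing $N_{k+1}$ for all $k$. Then: (1) the congruence box space $\square_{(\Gamma(5^k))}\Gamma$ has property $D_{1/3}$; (2) if a congruence box space $\square_{(\Gamma(N_k))}\Gamma$ has property $D_\alpha$, then $\alpha\le\frac13$; (3) there exists a congruence box space $\square_{(\Gamma(N_k))}\Gamma$ which, for every $\alpha\in(0,1]$, does not have property $D_\alpha$.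
   Context: Box space: for a finitely generated residually finite group $G$ with a fixed finite generating set $S$ and a filtration $(M_k)_{k>0}$ (a decreasing sequence of finite index normal subgroups with trivial intersection), $\square_{(M_k)}G$ is the coarse disjoint union of the Cayley graphs of the quotients $G/M_k$ with respect to the image of $S$, with their word metrics. For $\alpha\in(0,1]$, $\square_{(M_k)}G$ has property $D_\alpha$ if there exists $K>0$ such that $\mathrm{diam}(G/M)\ge K\,|G/M|^\alpha$ for every component $G/M$ (with $M\neq G$). "Increasing" for sequences $(N_k)$ means strictly increasing. *)

theory Defs
  imports
    "HOL-Analysis.Analysis"
    "HOL-Algebra.Coset"
    "HOL-Algebra.Generated_Groups"
    "HOL-Number_Theory.Cong"
begin

section \<open>Box spaces\<close>

definition generating_set :: "('a, 'b) monoid_scheme \<Rightarrow> 'a set \<Rightarrow> bool" where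
  "generating_set G S \<longleftrightarrow> S \<subseteq> carrier G \<and> generate G S = carrier G"

text \<open>Sequences are indexed by the positive integers; the value at \<open>0\<close> is never used.\<close>

definition filtration :: "('a, 'b) monoid_scheme \<Rightarrow> (nat \<Rightarrow> 'a set) \<Rightarrow> bool" where
  "filtration G M \<longleftrightarrow>
     (\<forall>k\<ge>1. M k \<lhd> G \<and> finite (rcosets\<^bsub>G\<^esub> (M k)) \<and> M (Suc k) \<subseteq> M k) \<and>
     (\<Inter>k\<in>{1..}. M k) = {\<one>\<^bsub>G\<^esub>}"

text \<open>The Cayley graph is undirected: the generating set need not be closed under inverses.\<close>

definition cayley_graph :: "('a, 'b) monoid_scheme \<Rightarrow> 'a set \<Rightarrow> ('a \<times> 'a) set" where
  "cayley_graph G S =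
     {(x, y). x \<in> carrier G \<and> y \<in> carrier G \<and> (\<exists>s\<in>S. y = x \<otimes>\<^bsub>G\<^esub> s \<or> x = y \<otimes>\<^bsub>G\<^esub> s)}"

definition graph_dist :: "('a \<times> 'a) set \<Rightarrow> 'a \<Rightarrow> 'a \<Rightarrow> real" where
  "graph_dist E x y = real (LEAST n. (x, y) \<in> E ^^ n)"

text \<open>The library's \<open>diameter\<close> is restricted to type-class metric spaces, hence the
  following version for an explicit distance function.\<close>

definition diam_of :: "('a \<Rightarrow> 'a \<Rightarrow> real) \<Rightarrow> 'a set \<Rightarrow> real" where
  "diam_of d X = (if X = {} then 0 else SUP (x, y)\<in>X \<times> X. d x y)"

text \<open>Metric of the coarse disjoint union of finite metric spaces \<open>(X k, d k)\<close>, on the set of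
  pairs \<open>(k, x)\<close> with \<open>x \<in> X k\<close>. Each component keeps its own metric, and the
  distance between distinct components \<open>k\<close> and \<open>l\<close> tends to infinity as \<open>k + l\<close> does; such a
  metric is determined up to coarse equivalence.\<close>

definition coarse_union_dist ::
  "(nat \<Rightarrow> 'a set) \<Rightarrow> (nat \<Rightarrow> 'a \<Rightarrow> 'a \<Rightarrow> real) \<Rightarrow> nat \<times> 'a \<Rightarrow> nat \<times> 'a \<Rightarrow> real" where
  "coarse_union_dist X d = (\<lambda>(k, x) (l, y).
     if k = l then d k x y
     else diam_of (d k) (X k) + diam_of (d l) (X l) + real (k + l))"

definition box_component :: "('a, 'b) monoid_scheme \<Rightarrow> (nat \<Rightarrow> 'a set) \<Rightarrow> nat \<Rightarrow> (nat \<times> 'a set) set"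
  where "box_component G M k = {k} \<times> carrier (G Mod M k)"

definition box_dist ::
  "('a, 'b) monoid_scheme \<Rightarrow> 'a set \<Rightarrow> (nat \<Rightarrow> 'a set) \<Rightarrow> nat \<times> 'a set \<Rightarrow> nat \<times> 'a set \<Rightarrow> real" where
  "box_dist G S M = coarse_union_dist (\<lambda>k. carrier (G Mod M k))
     (\<lambda>k. graph_dist (cayley_graph (G Mod M k) ((\<lambda>s. M k #>\<^bsub>G\<^esub> s) ` S)))"

definition property_D ::
  "real \<Rightarrow> ('a, 'b) monoid_scheme \<Rightarrow> 'a set \<Rightarrow> (nat \<Rightarrow> 'a set) \<Rightarrow> bool" where
  "property_D \<alpha> G S M \<longleftrightarrow>
     (\<exists>K>0. \<forall>k\<ge>1. M k \<noteq> carrier G \<longrightarrow>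
        diam_of (box_dist G S M) (box_component G M k)
          \<ge> K * real (card (box_component G M k)) powr \<alpha>)"

section \<open>The group and its congruence subgroups\<close>

definition GL_int :: "(int ^ 'n ^ 'n) monoid" where
  "GL_int = \<lparr>carrier = {X. invertible X}, mult = (**), one = mat 1\<rparr>"

definition A_mat :: "int ^ 2 ^ 2" where
  "A_mat = vector [vector [1, 1], vector [1, 0]]"

text \<open>Powers are taken in the group \<open>GL_int\<close>, so that negative exponents make sense. (The
  type-class product on \<open>int ^ 2 ^ 2\<close> is entrywise.)\<close>

abbreviation A_pow :: "int \<Rightarrow> int ^ 2 ^ 2" where
  "A_pow k \<equiv> A_mat [^]\<^bsub>GL_int\<^esub> k"

definition Gamma_group :: "((int ^ 2) \<times> int) monoid" where
  "Gamma_group = \<lparr>carrier = UNIV,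
            mult = (\<lambda>(v, k) (w, l). (v + A_pow k *v w, k + l)),
            one = (0, 0)\<rparr>"

definition Gamma_embed :: "(int ^ 2) \<times> int \<Rightarrow> int ^ 3 ^ 3" where
  "Gamma_embed = (\<lambda>(v, k). vector
     [vector [A_pow k $ 1 $ 1, A_pow k $ 1 $ 2, v $ 1],
      vector [A_pow k $ 2 $ 1, A_pow k $ 2 $ 2, v $ 2],
      vector [0, 0, 1]])"

text \<open>The kernel of reduction modulo \<open>N\<close> on \<open>GL\<^sub>3(\<int>)\<close>.\<close>

definition principal_congruence :: "nat \<Rightarrow> (int ^ 3 ^ 3) set" where
  "principal_congruence N =
     {X \<in> carrier GL_int. \<forall>i j. [X $ i $ j = mat 1 $ i $ j] (mod int N)}"

definition Gamma_cong :: "nat \<Rightarrow> ((int ^ 2) \<times> int) set" where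
  "Gamma_cong N = {g \<in> carrier Gamma_group. Gamma_embed g \<in> principal_congruence N}"

text \<open>The filtration condition is implied by the arithmetic one; it is kept because a congruence box
  space is by definition a box space.\<close>

definition congruence_box :: "(nat \<Rightarrow> nat) \<Rightarrow> bool" where
  "congruence_box N \<longleftrightarrow>
     (\<forall>k\<ge>1. 0 < N k \<and> N k < N (Suc k) \<and> N k dvd N (Suc k)) \<and>
     filtration Gamma_group (\<lambda>k. Gamma_cong (N k))"

end

theory Submission
  imports Defs "HOL-Number_Theory.Fib" "HOL-Number_Theory.Residues" "HOL-Real_Asymp.Real_Asymp"
begin

text \<open>Identify \<open>\<int>\<^sup>2\<close> with \<open>\<int>[\<phi>]\<close>, \<open>\<phi>\<close> the golden ratio, so that \<open>A\<close> acts as multiplication by \<open>\<phi>\<close>. If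
  \<open>\<pi>(N)\<close> is the order of \<open>\<phi>\<close> modulo \<open>N\<close>, then \<open>\<Gamma>/\<Gamma>(N)\<close> has \<open>N\<^sup>2\<pi>(N)\<close> elements. Its diameter is
  comparable to \<open>\<pi>(N)\<close>: it is at least of that order because of the projection to \<open>\<int>/\<pi>(N)\<close>, and
  at most because \<open>\<int>\<^sup>2\<close> is exponentially distorted in \<open>\<Gamma>\<close> and \<open>N\<close> is at most exponential in
  \<open>\<pi>(N)\<close>. The claims thus follow from \<open>\<pi>(5\<^sup>k) \<ge> 5\<^sup>k\<close>, \<open>\<pi>(N) \<le> 8N\<close>, and
  \<open>\<pi>(F\<^sub>n) \<le> 4n\<close> for the Fibonacci numbers \<open>F\<^sub>n\<close>.\<close>

section \<open>The ring of integers of the golden field\<close>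

text \<open>Since a component has N^2 pi(N) points and diameter comparable to pi(N), property
  D_alpha with alpha < 1 demands pi(N) >= c N^(2 alpha / (1 - alpha)) for some c > 0 along the
  sequence. At alpha = 1/3 this is linear growth, the most that pi(N) <= 8N allows. Distortion
  arises because conjugation by (0,1) multiplies by phi, so a word of length O(n) can spell a sum of
  bounded digits times powers up to phi^n. The sum has to be a prescribed rational integer, which is
  why powers are paired as phi^(2j) + phi^(-2j), the trace of phi^(2j). N is at most exponential in
  pi(N) because phi^m = 1 modulo N forces N to divide F_m. The two special sequences are opposite
  extremes. Modulo 5 the square of sqrt 5 vanishes, so (2 phi)^n = 1 + n sqrt 5, the source of 5^k
  dividing pi(5^k). Modulo F_n the power phi^n is already an integer with square 1 or -1.\<close>

datatype zphi = Zphi (re: int) (im: int)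

text \<open>\<open>Zphi a b\<close> stands for a + b phi; the product is dictated by phi^2 = phi +
  1.\<close>

instantiation zphi :: comm_ring_1
begin
definition "0 = Zphi 0 0"
definition "1 = Zphi 1 0"
definition "x + y = Zphi (re x + re y) (im x + im y)"
definition "x - y = Zphi (re x - re y) (im x - im y)"
definition "- x = Zphi (- re x) (- im x)"
definition "x * y = Zphi (re x * re y + im x * im y) (re x * im y + im x * re y + im x * im y)"
instance
  by standard
    (simp_all add: zero_zphi_def one_zphi_def plus_zphi_def minus_zphi_def uminus_zphi_def
      times_zphi_def algebra_simps)
end

lemma zphi_sel [simp]:
  "re 0 = 0" "im 0 = 0" "re 1 = 1" "im 1 = 0"
  "re (x + y) = re x + re y" "im (x + y) = im x + im y"
  "re (x - y) = re x - re y" "im (x - y) = im x - im y"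
  "re (- x) = - re x" "im (- x) = - im x"
  "re (x * y) = re x * re y + im x * im y"
  "im (x * y) = re x * im y + im x * re y + im x * im y"
  by (simp_all add: zero_zphi_def one_zphi_def plus_zphi_def minus_zphi_def uminus_zphi_def
      times_zphi_def)

lemma zphi_of_nat_sel [simp]: "re (of_nat n) = int n" "im (of_nat n) = 0"
  by (induction n) auto

lemma zphi_of_int_sel [simp]: "re (of_int k) = k" "im (of_int k) = 0"
  by (cases k rule: int_cases2; simp)+

lemma zphi_numeral_sel [simp]: "re (numeral k) = numeral k" "im (numeral k) = 0"
  using zphi_of_nat_sel[of "numeral k"] by simp_all

lemma of_int_dvd_zphi_iff: "of_int n dvd z \<longleftrightarrow> n dvd re z \<and> n dvd im z"
proof
  assume "n dvd re z \<and> n dvd im z"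
  then obtain a b where "re z = n * a" "im z = n * b" by (auto simp: dvd_def)
  then have "z = of_int n * Zphi a b" by (simp add: zphi.expand)
  then show "of_int n dvd z" by simp
qed (auto simp: dvd_def)

definition phi :: zphi where "phi = Zphi 0 1"

lemma phi_sel [simp]: "re phi = 0" "im phi = 1"
  by (simp_all add: phi_def)

lemma phi_mult_inverse: "phi * (phi - 1) = 1"
  by (rule zphi.expand) simp

lemma phi_squared: "phi * phi = phi + 1"
  by (rule zphi.expand) simp

lemma phi_power_Suc: "phi ^ Suc n = of_nat (fib (Suc n)) * phi + of_nat (fib n)"
  by (induction n) (auto intro!: zphi.expand simp: power_Suc2 simp del: power_Suc)

text \<open>phi - 1 is the inverse of phi, so integer exponents make sense inside the ring.\<close>

definition phi_pow :: "int \<Rightarrow> zphi" where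
  "phi_pow k = (if 0 \<le> k then phi ^ nat k else (phi - 1) ^ nat (- k))"

lemma phi_pow_0 [simp]: "phi_pow 0 = 1" and phi_pow_1 [simp]: "phi_pow 1 = phi"
  by (simp_all add: phi_pow_def)

lemma phi_pow_of_nat: "phi_pow (int n) = phi ^ n"
  by (simp add: phi_pow_def)

lemma phi_pow_add_1: "phi_pow (k + 1) = phi * phi_pow k"
proof (cases "0 \<le> k")
  case True
  then show ?thesis by (simp add: phi_pow_def nat_add_distrib)
next
  case False
  then have "nat (- k) = Suc (nat (- (k + 1)))" by simp
  with False have "phi_pow k = (phi - 1) * (phi - 1) ^ nat (- (k + 1))"
    by (simp add: phi_pow_def)
  then have "phi * phi_pow k = (phi - 1) ^ nat (- (k + 1))"
    using phi_mult_inverse by (metis mult.assoc mult_1)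
  with False show ?thesis by (auto simp: phi_pow_def)
qed

lemma phi_pow_add: "phi_pow (k + l) = phi_pow k * phi_pow l"
proof (induction k rule: int_induct[of _ 0])
  case (step1 i)
  then show ?case using phi_pow_add_1[of "i + l"] phi_pow_add_1[of i] by (simp add: ac_simps)
next
  case (step2 i)
  have "phi * phi_pow (i - 1 + l) = phi * (phi_pow (i - 1) * phi_pow l)"
    using step2 phi_pow_add_1[of "i - 1 + l"] phi_pow_add_1[of "i - 1"] by (simp add: ac_simps)
  then show ?case using phi_mult_inverse by (metis mult.assoc mult.commute mult_1)
qed simp

lemma phi_pow_uminus: "phi_pow k * phi_pow (- k) = 1"
  using phi_pow_add[of k "- k"] by simp

section \<open>The period of the golden unit modulo an integer\<close>

lemma coprime_mult_dvd_zphi: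
  fixes a b :: nat
  assumes "coprime a b" "of_nat a dvd (z :: zphi)" "of_nat b dvd z"
  shows "of_nat (a * b) dvd z"
proof -
  have "of_int (int a) dvd z" "of_int (int b) dvd z" "coprime (int a) (int b)"
    using assms by simp_all
  then have "of_int (int a * int b) dvd z"
    unfolding of_int_dvd_zphi_iff by (auto intro: divides_mult)
  then show ?thesis by simp
qed

lemma cancel_dvd_zphi:
  assumes "coprime a (int n)" "of_nat n dvd of_int a * z"
  shows "of_nat n dvd (z :: zphi)"
proof -
  have "of_int (int n) dvd of_int a * z" using assms by simp
  then have "of_int (int n) dvd z"
    using assms(1) unfolding of_int_dvd_zphi_iff
    by (auto simp: coprime_dvd_mult_right_iff coprime_commute)
  then show ?thesis by simp
qed

lemma cancel_phi_dvd: "x dvd phi * z \<longleftrightarrow> x dvd z"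
  using phi_mult_inverse by (metis dvd_mult mult.assoc mult.left_commute mult_1)

lemma power_minus_one_dvd:
  fixes x :: "'a::comm_ring_1"
  assumes "a dvd x - 1"
  shows "a dvd x ^ n - 1"
  using assms by (simp add: power_diff_1_eq)

text \<open>In x^n - 1 = (x - 1)(1 + x + ... + x^(n-1)) every summand is 1 modulo n, so the second
  factor is divisible by n. Thus enlarging a modulus by a prime that already divides it multiplies
  the exponent by that prime only.\<close>

lemma power_minus_one_dvd_lift:
  fixes x :: "'a::comm_ring_1"
  assumes "a dvd x - 1" "of_nat n dvd a"
  shows "of_nat n * a dvd x ^ n - 1"
proof -
  have eq: "x ^ n - 1 = (x - 1) * (\<Sum>i<n. x ^ i)"
    using power_diff_1_eq[of x n] by simp
  have "of_nat n dvd (\<Sum>i<n. x ^ i) - (\<Sum>i<n. 1)"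
    unfolding sum_subtractf[symmetric]
    using assms by (intro dvd_sum power_minus_one_dvd) (meson dvd_trans)
  then have "of_nat n dvd (\<Sum>i<n. x ^ i)"
    using dvd_add_times_triv_right_iff[of "of_nat n :: 'a" "(\<Sum>i<n. x ^ i) - (\<Sum>i<n. 1)" 1] by simp
  with assms(1) show ?thesis unfolding eq by (subst mult.commute) (rule mult_dvd_mono)
qed

lemma frobenius_dvd:
  fixes x y :: "'a::comm_ring_1"
  assumes "prime p"
  shows "of_nat p dvd (x + y) ^ p - x ^ p - y ^ p"
proof -
  have p: "p > 0" using assms prime_gt_0_nat by blast
  have "(x + y) ^ p = (\<Sum>k\<le>p. of_nat (p choose k) * x ^ k * y ^ (p - k))"
    by (rule binomial_ring)
  also have "{..p} = insert 0 (insert p {0<..<p})" using p by auto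
  also have "(\<Sum>k\<in>\<dots>. of_nat (p choose k) * x ^ k * y ^ (p - k))
      = y ^ p + x ^ p + (\<Sum>k\<in>{0<..<p}. of_nat (p choose k) * x ^ k * y ^ (p - k))"
    using p by simp
  finally have "(x + y) ^ p - x ^ p - y ^ p
      = (\<Sum>k\<in>{0<..<p}. of_nat (p choose k) * x ^ k * y ^ (p - k))" by simp
  also have "of_nat p dvd \<dots>"
  proof (intro dvd_sum dvd_mult2)
    fix k assume "k \<in> {0<..<p}"
    then have "p dvd (p choose k)" using assms by (intro dvd_choose_prime) auto
    then show "of_nat p dvd (of_nat (p choose k) :: 'a)" by (auto simp: dvd_def)
  qed
  finally show ?thesis .
qed

lemma im_phi_power: "im (phi ^ n) = int (fib n)"
  by (cases n) (simp_all add: phi_power_Suc del: power_Suc)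

lemma sqrt5_squared: "(2 * phi - 1) * (2 * phi - 1) = 5"
  by (rule zphi.expand) simp

lemma of_int_dvd_of_int_zphi: "n dvd k \<Longrightarrow> of_int n dvd (of_int k :: zphi)"
  by (simp add: of_int_dvd_zphi_iff)

text \<open>Modulo F_n the power phi^n collapses to the integer F_(n-1), whose square is 1 or -1 by
  Cassini; its fourth power is therefore 1.\<close>

lemma fib_dvd_phi_power:
  assumes "0 < n"
  shows "of_nat (fib n) dvd phi ^ (4 * n) - 1"
proof -
  obtain k where k: "n = Suc k" using assms by (cases n) auto
  define c where "c = int (fib k)"
  define e :: int where "e = (-1) ^ k"
  have e: "e * e = 1" by (simp add: e_def flip: power_add mult_2)
  have "int (fib (Suc (Suc k)) * fib k) - (int (fib (Suc k)))\<^sup>2 = - e"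
    using fib_Cassini_int[of k] by (simp add: e_def)
  then have "c * c + e = int (fib n) * (int (fib n) - c)"
    by (simp add: k c_def algebra_simps power2_eq_square)
  then have "int (fib n) dvd (c * c + e) * (c * c - e)" by simp
  also have "\<dots> = c ^ 4 - 1"
    using e by (simp add: algebra_simps power4_eq_xxxx)
  finally have "of_nat (fib n) dvd (of_int (c ^ 4 - 1) :: zphi)"
    using of_int_dvd_of_int_zphi[of "int (fib n)" "c ^ 4 - 1"] by simp
  moreover have "of_nat (fib n) dvd phi ^ n - of_int c"
    by (simp add: k c_def phi_power_Suc del: power_Suc fib.simps)
  then have "of_nat (fib n) dvd (phi ^ n) ^ 4 - of_int c ^ 4"
    by (metis dvd_mult2 power_diff_sumr2)
  ultimately have "of_nat (fib n) dvd (phi ^ n) ^ 4 - of_int c ^ 4 + of_int (c ^ 4 - 1)"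
    by (rule dvd_add[rotated])
  then show ?thesis by (simp add: power_mult[symmetric] mult_ac)
qed

text \<open>Apply Frobenius to \<open>\<surd>5 = 2\<phi> - 1\<close>: as \<open>\<surd>5\<^sup>p = 5\<^bsup>(p - 1)/2\<^esup>\<surd>5 \<equiv> \<plusminus>\<surd>5\<close>, the power \<open>\<phi>\<^sup>p\<close> is
  congruent to \<open>\<phi>\<close> or to its conjugate.\<close>

lemma prime_period:
  assumes p: "prime p" "p \<noteq> 2" "p \<noteq> 5"
  shows "\<exists>m>0. m \<le> p \<and> of_nat p dvd phi ^ (4 * m) - 1"
proof -
  define h where "h = p div 2"
  have p2: "p > 2" using p prime_ge_2_nat[of p] by simp
  then have "odd p" using p prime_odd_nat by blast
  then have ph: "p = 2 * h + 1" by (simp add: h_def)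
  define D where "D = 2 * phi - 1"
  have DD: "D * D = 5" unfolding D_def by (rule sqrt5_squared)
  have np2: "\<not> p dvd 2" using p2 by (simp add: nat_dvd_not_less)
  have np5: "\<not> p dvd 5" using primes_dvd_imp_eq[of p 5] p by auto
  have cop: "coprime 2 (int p)"
    using \<open>odd p\<close> by simp
  have "[2 ^ (p - 1) = 1] (mod p)" using fermat_theorem p np2 by blast
  then have "[2 * 2 ^ (p - 1) = 2 * 1] (mod p)" by (rule cong_scalar_left)
  then have "[2 ^ p = 2] (mod p)" using p2 by (simp add: ph)
  then have "[int (2 ^ p) = int 2] (mod int p)" by (simp only: cong_int_iff)
  then have "int p dvd 2 - 2 ^ p" by (simp add: cong_iff_dvd_diff dvd_diff_commute)
  then have two: "of_nat p dvd (2 - 2 ^ p :: zphi)"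
    using of_int_dvd_of_int_zphi[of "int p" "2 - 2 ^ p"] by simp
  have "[5 ^ (p - 1) = 1] (mod p)" using fermat_theorem p np5 by blast
  then have "[int (5 ^ (p - 1)) = int 1] (mod int p)" by (simp only: cong_int_iff)
  then have "int p dvd 5 ^ (2 * h) - 1" by (simp add: cong_iff_dvd_diff ph)
  also have "5 ^ (2 * h) - 1 = (5 ^ h - 1) * (5 ^ h + 1 :: int)"
    by (simp add: power_mult power2_eq_square algebra_simps mult_2 power_add)
  finally have "int p dvd 5 ^ h - 1 \<or> int p dvd 5 ^ h - (-1)"
    using p by (simp add: prime_dvd_mult_iff)
  then obtain s :: int where s: "s = 1 \<or> s = -1" "int p dvd 5 ^ h - s" by blast
  then have five: "of_nat p dvd (5 ^ h - of_int s :: zphi)"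
    using of_int_dvd_of_int_zphi[of "int p" "5 ^ h - s"] by simp
  have Dp: "D ^ p = 5 ^ h * D" by (simp add: ph power_mult power2_eq_square DD)
  have "of_nat p dvd (2 * phi + (-1)) ^ p - (2 * phi) ^ p - (-1) ^ p"
    using p by (intro frobenius_dvd)
  then have "of_nat p dvd D ^ p - 2 ^ p * phi ^ p + 1"
    using \<open>odd p\<close> by (simp add: D_def power_mult_distrib)
  \<comment> \<open>This combination replaces 2^p by 2 and 5^h by s, leaving 2 phi^p = 1 + s sqrt 5
    modulo p.\<close>
  then have "of_nat p dvd (2 - 2 ^ p) * phi ^ p - (D ^ p - 2 ^ p * phi ^ p + 1)
      + (5 ^ h - of_int s) * D"
    using two five by (blast intro: dvd_add dvd_diff dvd_mult2)
  then have main: "of_nat p dvd 2 * phi ^ p - 1 - of_int s * D"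
    by (simp add: Dp algebra_simps)
  show ?thesis
  proof (cases "s = 1")
    case True
    with main have "of_nat p dvd of_int 2 * (phi ^ p - phi)"
      by (simp add: D_def algebra_simps)
    then have "of_nat p dvd phi ^ p - phi" using cop by (rule cancel_dvd_zphi[rotated])
    also have "phi ^ p - phi = phi * (phi ^ (2 * h) - 1)" by (simp add: ph algebra_simps)
    finally have "of_nat p dvd phi ^ (2 * h) - 1" by (simp only: cancel_phi_dvd)
    \<comment> \<open>The exponent 2h = p - 1 already works; the fourth power only produces the
      common form 4m.\<close>
    then have "of_nat p dvd (phi ^ (2 * h)) ^ 4 - 1" by (rule power_minus_one_dvd)
    then show ?thesis using p2
      by (intro exI[of _ "2 * h"]) (simp add: ph power_mult[symmetric] mult_ac)
  next
    case False
    with s have "s = -1" by simp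
    with main have "of_nat p dvd of_int 2 * (phi ^ p + phi - 1)"
      by (simp add: D_def algebra_simps)
    then have "of_nat p dvd phi ^ p + phi - 1" using cop by (rule cancel_dvd_zphi[rotated])
    \<comment> \<open>Here phi^p is the conjugate 1 - phi = -1/phi, so phi^(p+1) is -1 modulo p, and
      the exponent 2(p + 1) = 4(h + 1) gives 1.\<close>
    then have "of_nat p dvd phi * (phi ^ p + phi - 1)" by simp
    also have "\<dots> = phi ^ (p + 1) + 1" using phi_squared by (simp add: algebra_simps)
    finally have "of_nat p dvd (phi ^ (p + 1) + 1) * (phi ^ (p + 1) - 1)" by (rule dvd_mult2)
    also have "\<dots> = phi ^ (p + 1) * phi ^ (p + 1) - 1" by (simp add: algebra_simps)
    also have "\<dots> = phi ^ (p + 1 + (p + 1)) - 1" by (simp only: power_add)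
    also have "p + 1 + (p + 1) = 4 * (h + 1)" by (simp add: ph)
    finally show ?thesis using p2 by (intro exI[of _ "h + 1"]) (simp add: ph)
  qed
qed

text \<open>Periods modulo coprime numbers combine by least common multiple, so the factor \<open>4\<close> is not
  multiplied up over the primes dividing \<open>N\<close>; this keeps the bound linear in \<open>N\<close>.\<close>

lemma ex_period_le:
  assumes "N > 0"
  shows "\<exists>m>0. m \<le> (if even N then 2 * N else N) \<and> of_nat N dvd phi ^ (4 * m) - 1"
  using assms
proof (induction N rule: less_induct)
  case (less N)
  show ?case
  proof (cases "N = 1")
    case False
    then obtain p where p: "prime p" "p dvd N" using prime_factor_nat by blast
    then obtain M where M: "N = p * M" by (auto simp: dvd_def)
    have p2: "p \<ge> 2" using p prime_ge_2_nat by blast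
    have "0 < M" "M < N" using less.prems M p2 by auto
    then obtain m where m: "m > 0" "m \<le> (if even M then 2 * M else M)"
      and dvd: "of_nat M dvd phi ^ (4 * m) - 1" using less.IH by blast
    show ?thesis
    proof (cases "p dvd M")
      case True
      then have "of_nat p dvd (of_nat M :: zphi)" by (auto simp: dvd_def)
      with dvd have "of_nat p * of_nat M dvd (phi ^ (4 * m)) ^ p - 1"
        by (rule power_minus_one_dvd_lift)
      then have "of_nat N dvd phi ^ (4 * (p * m)) - 1"
        by (simp add: M power_mult[symmetric] mult_ac)
      moreover have "even N \<longleftrightarrow> even M" using M True by auto
      moreover have "p * m \<le> (if even M then 2 * N else N)"
        using mult_le_mono2[OF m(2), of p] by (simp add: M mult_ac split: if_splits)
      ultimately show ?thesis using m(1) p2 by (intro exI[of _ "p * m"]) simp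
    next
      case False
      then have cop: "coprime p M" using p(1) by (simp add: prime_imp_coprime)
      have "\<exists>q>0. q \<le> (if even p then 2 * p else p) \<and> of_nat p dvd phi ^ (4 * q) - 1"
      proof -
        consider "p = 2" | "p = 5" | "p \<noteq> 2" "p \<noteq> 5" by blast
        then show ?thesis
        proof cases
          case 1
          \<comment> \<open>The two primes excluded from the Frobenius argument are the Fibonacci
            numbers F_3 = 2 and F_5 = 5. The value 3 > 2 found here is why even N get the weaker
            bound 2N.\<close>
          have "of_nat (fib 3) dvd phi ^ (4 * 3) - 1" by (rule fib_dvd_phi_power) simp
          moreover have "fib 3 = 2" by (simp add: eval_nat_numeral)
          ultimately show ?thesis using 1 by (intro exI[of _ 3]) simp
        next
          case 2
          have "of_nat (fib 5) dvd phi ^ (4 * 5) - 1" by (rule fib_dvd_phi_power) simp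
          moreover have "fib 5 = 5" by (simp add: eval_nat_numeral)
          ultimately show ?thesis using 2 by (intro exI[of _ 5]) simp
        next
          case 3
          then obtain q where "q > 0" "q \<le> p" "of_nat p dvd phi ^ (4 * q) - 1"
            using prime_period[OF p(1)] by blast
          then show ?thesis by (intro exI[of _ q]) simp
        qed
      qed
      then obtain q where q: "q > 0" "q \<le> (if even p then 2 * p else p)"
        and qd: "of_nat p dvd phi ^ (4 * q) - 1" by blast
      have "of_nat M dvd (phi ^ (4 * m)) ^ q - 1" "of_nat p dvd (phi ^ (4 * q)) ^ m - 1"
        using dvd qd by (auto intro: power_minus_one_dvd)
      then have "of_nat N dvd phi ^ (4 * (m * q)) - 1"
        unfolding M using cop by (intro coprime_mult_dvd_zphi)
          (simp_all add: power_mult[symmetric] mult_ac)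
      \<comment> \<open>At most one of the two factors is even, so the extra factor 2 is paid only
        once.\<close>
      moreover have "\<not> (even p \<and> even M)"
        using cop by (metis coprime_common_divisor even_add odd_one)
      then have "m * q \<le> (if even N then 2 * N else N)"
        using mult_le_mono[OF m(2) q(2)] by (auto simp: M mult_ac split: if_splits)
      ultimately show ?thesis using m(1) q(1) by (intro exI[of _ "m * q"]) simp
    qed
  qed (auto intro!: exI[of _ 1])
qed

text \<open>This is the Pisano period: for N > 0, the period of the Fibonacci sequence modulo
  N.\<close>

definition period :: "nat \<Rightarrow> nat" where
  "period N = (LEAST m. 0 < m \<and> of_nat N dvd phi ^ m - 1)"

lemma period:
  assumes "N > 0"
  shows period_pos: "0 < period N" and period_dvd: "of_nat N dvd phi ^ period N - 1"
    and period_le: "period N \<le> 8 * N"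
proof -
  obtain m where m: "m > 0" "m \<le> (if even N then 2 * N else N)" "of_nat N dvd phi ^ (4 * m) - 1"
    using ex_period_le[OF assms] by blast
  then have ex: "0 < 4 * m \<and> of_nat N dvd phi ^ (4 * m) - 1" by simp
  show "0 < period N" "of_nat N dvd phi ^ period N - 1"
    using LeastI[where P = "\<lambda>m. 0 < m \<and> of_nat N dvd phi ^ m - 1", OF ex]
    unfolding period_def by auto
  \<comment> \<open>The 8 is this factor 4 times the factor 2 allowed for even N.\<close>
  have "period N \<le> 4 * m" unfolding period_def using ex by (rule Least_le)
  with m show "period N \<le> 8 * N" by (simp split: if_splits)
qed

lemma of_nat_dvd_phi_pow_iff:
  assumes "N > 0"
  shows "of_nat N dvd phi_pow k - 1 \<longleftrightarrow> int (period N) dvd k"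
proof -
  define m where "m = period N"
  note m = period_pos[OF assms] period_dvd[OF assms]
  have mult: "of_nat N dvd phi_pow (int m * q) - 1" for q
  proof -
    have nat: "of_nat N dvd phi_pow (int m * int n) - 1" for n
      using power_minus_one_dvd[OF m(2), of n]
      by (simp add: m_def power_mult[symmetric] phi_pow_of_nat flip: of_nat_mult)
    show ?thesis
    proof (cases q rule: int_cases2)
      case (nonpos n)
      have "phi_pow (int m * q) - 1 = - phi_pow (int m * q) * (phi_pow (int m * int n) - 1)"
        using phi_pow_uminus[of "int m * int n"] nonpos by (simp add: algebra_simps)
      then show ?thesis using nat by simp
    qed (use nat in simp)
  qed
  show ?thesis
  proof
    assume "int (period N) dvd k"
    then show "of_nat N dvd phi_pow k - 1" using mult by (auto simp: m_def)
  next
    assume dvd: "of_nat N dvd phi_pow k - 1"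
    define r where "r = nat (k mod int m)"
    have r: "int r = k mod int m" "r < m" using m by (auto simp: r_def m_def nat_less_iff)
    have "k = int m * (k div int m) + int r" by (simp add: r)
    then have "phi_pow k = phi_pow (int m * (k div int m)) * phi ^ r"
      by (metis phi_pow_add phi_pow_of_nat)
    then have "phi ^ r - 1 = (phi_pow k - 1) - phi ^ r * (phi_pow (int m * (k div int m)) - 1)"
      by (simp add: algebra_simps)
    moreover have "of_nat N dvd \<dots>" using dvd mult by (blast intro: dvd_diff dvd_mult)
    ultimately have "of_nat N dvd phi ^ r - 1" by (simp only:)
    then have "r = 0" using r(2) not_less_Least[of r "\<lambda>m. 0 < m \<and> of_nat N dvd phi ^ m - 1"]
      unfolding m_def period_def by auto
    then show "int (period N) dvd k" using r(1) by (simp add: m_def dvd_eq_mod_eq_0)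
  qed
qed

text \<open>The phi-coordinate of \<open>phi ^ m - 1\<close> is F_m. Lower bounds on periods are
  obtained by passing to Fibonacci numbers in this way.\<close>

lemma dvd_fib_if_dvd_phi_power:
  assumes "of_nat N dvd phi ^ m - 1"
  shows "N dvd fib m"
proof -
  have "of_int (int N) dvd phi ^ m - 1" using assms by simp
  then show ?thesis unfolding of_int_dvd_zphi_iff by (simp add: im_phi_power)
qed

lemma fib_le_two_power: "fib n \<le> 2 ^ n"
  by (induction n rule: fib.induct) auto

lemma le_two_power_if_dvd_phi_power:
  assumes "of_nat N dvd phi ^ m - 1" "0 < m"
  shows "N \<le> 2 ^ m"
  using dvd_fib_if_dvd_phi_power[OF assms(1)] fib_neq_0_nat[OF assms(2)] fib_le_two_power[of m]
  by (meson dvd_imp_le le_trans)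

section \<open>The period modulo powers of five\<close>

text \<open>The left side is the norm of \<open>phi ^ n\<close>, and phi has norm -1.\<close>

lemma phi_power_norm:
  "re (phi ^ n) ^ 2 + re (phi ^ n) * im (phi ^ n) - im (phi ^ n) ^ 2 = (-1) ^ n"
  by (induction n) (simp_all add: algebra_simps power2_eq_square)

text \<open>Since 2 phi = 1 + D with D^2 = 5, only the linear term of the binomial expansion
  survives modulo 5: (2 phi)^n = 1 + nD. Comparing phi-coordinates gives 2^n F_n = 2n modulo
  5.\<close>

lemma five_dvd_if_dvd_fib:
  assumes "5 dvd fib n"
  shows "5 dvd n"
proof -
  define D where "D = 2 * phi - 1"
  have "of_int 5 dvd (2 * phi) ^ n - (1 + of_nat n * D)"
  proof (induction n)
    case (Suc n)
    have "(2 * phi) ^ Suc n - (1 + of_nat (Suc n) * D)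
        = ((2 * phi) ^ n - (1 + of_nat n * D)) * (2 * phi) + of_nat n * (D * D)"
      by (simp add: D_def algebra_simps)
    also have "D * D = of_int 5" using sqrt5_squared by (simp add: D_def)
    finally show ?case by (metis Suc dvd_add dvd_mult dvd_mult2 dvd_refl)
  qed simp
  moreover have two: "re (2 ^ n) = 2 ^ n" "im (2 ^ n) = 0" for n
    using zphi_of_nat_sel[of "2 ^ n"] by simp_all
  ultimately have "5 dvd 2 ^ n * int (fib n) - 2 * int n"
    unfolding of_int_dvd_zphi_iff power_mult_distrib
    by (simp add: D_def im_phi_power two mult.commute)
  moreover have "5 dvd 2 ^ n * int (fib n)" using assms by (auto elim!: dvdE)
  ultimately have "5 dvd 2 * int n" by (metis dvd_diff diff_diff_eq2 add_diff_cancel_left')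
  then show ?thesis by presburger
qed

text \<open>Multiplying the index by 5 adds exactly one factor 5. Expand the fifth power of b + a
  phi and eliminate b through the norm relation; the cofactor becomes 5(a^4 + a^2 e) + 1.\<close>

lemma fib_times_five: "\<exists>u. fib (5 * n) = 5 * fib n * u \<and> \<not> 5 dvd u"
proof -
  define a b where "a = im (phi ^ n)" and "b = re (phi ^ n)"
  define e :: int where "e = (-1) ^ n"
  have norm: "b * b + a * b = a * a + e"
    using phi_power_norm[of n] by (simp add: a_def b_def e_def power2_eq_square algebra_simps)
  have e: "e * e = 1" by (simp add: e_def flip: power_add mult_2)
  define q where "q = a * a + e"
  define u where "u = q * q + 3 * a * a * q + a * a * a * a"
  have "z ^ 5 = z * (z * (z * (z * z)))" for z :: zphi by (simp add: eval_nat_numeral)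
  then have "im ((phi ^ n) ^ 5)
      = 5 * a * ((b * b + a * b) * (b * b + a * b) + 3 * a * a * (b * b + a * b) + a * a * a * a)"
    by (simp add: a_def b_def algebra_simps)
  then have fib: "int (fib (5 * n)) = 5 * int (fib n) * u"
    unfolding norm u_def q_def
    by (simp add: a_def power_mult[symmetric] im_phi_power mult.commute[of n])
  have "u = 5 * (a * a * a * a + a * a * e) + e * e"
    by (simp add: u_def q_def algebra_simps)
  then have "u mod 5 = 1" using e by presburger
  show ?thesis
  \<comment> \<open>For n = 0 both sides vanish and the cofactor is free; otherwise positivity turns
    u into a natural number.\<close>
  proof (cases "n = 0")
    case False
    then have "fib n > 0" "fib (5 * n) > 0" by (simp_all add: fib_neq_0_nat)
    with fib have "u > 0" by (smt (verit) of_nat_0_less_iff zero_less_mult_iff)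
    then obtain v where v: "u = int v" using zero_less_imp_eq_int by blast
    have "int (fib (5 * n)) = int (5 * fib n * v)" using fib v by simp
    then have "fib (5 * n) = 5 * fib n * v" by (simp only: of_nat_eq_iff)
    moreover have "\<not> 5 dvd v" using \<open>u mod 5 = 1\<close> v by presburger
    ultimately show ?thesis by blast
  qed (auto intro: exI[of _ 1])
qed

lemma five_power_dvd_if_dvd_fib:
  assumes "5 ^ k dvd fib n"
  shows "5 ^ k dvd n"
  using assms
proof (induction k arbitrary: n)
  case (Suc k)
  then have "5 dvd fib n" by (metis dvd_mult_left power_Suc)
  then obtain m where m: "n = 5 * m" using five_dvd_if_dvd_fib by (auto simp: dvd_def)
  obtain u where u: "fib n = 5 * fib m * u" "\<not> 5 dvd u" using fib_times_five m by blast
  have "prime (5::nat)" by simp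
  with u(2) have "coprime (5 ^ k) u" by (simp add: prime_imp_coprime)
  moreover have "5 ^ k dvd fib m * u" using Suc.prems u(1) by (simp add: mult.assoc)
  ultimately have "5 ^ k dvd m" using Suc.IH by (simp add: coprime_dvd_mult_left_iff)
  then show ?case by (simp add: m)
qed simp

lemma five_power_dvd_period: "5 ^ k dvd period (5 ^ k)"
  by (rule five_power_dvd_if_dvd_fib, rule dvd_fib_if_dvd_phi_power, rule period_dvd) simp

section \<open>The group in golden coordinates\<close>

text \<open>The phi-coordinate comes first because A sends (b, a) to (a + b, b), which are the
  coordinates of phi (a + b phi).\<close>

definition vec_of :: "zphi \<Rightarrow> int ^ 2" where "vec_of z = vector [im z, re z]"

text \<open>The matrix of multiplication by z in the basis (phi, 1).\<close>

definition mat_of :: "zphi \<Rightarrow> int ^ 2 ^ 2" where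
  "mat_of z = vector [vector [re z + im z, im z], vector [im z, re z]]"

lemma vec_of_nth [simp]: "vec_of z $ 1 = im z" "vec_of z $ 2 = re z"
  by (simp_all add: vec_of_def)

lemma mat_of_nth [simp]:
  "mat_of z $ 1 $ 1 = re z + im z" "mat_of z $ 1 $ 2 = im z"
  "mat_of z $ 2 $ 1 = im z" "mat_of z $ 2 $ 2 = re z"
  by (simp_all add: mat_of_def)

lemma vec_of_surj: "\<exists>z. v = vec_of z"
  by (rule exI[of _ "Zphi (v $ 2) (v $ 1)"]) (simp add: vec_eq_iff forall_2)

lemma vec_of_eq_iff [simp]: "vec_of z = vec_of w \<longleftrightarrow> z = w"
  by (metis vec_of_nth zphi.expand)

lemma vec_of_add: "vec_of z + vec_of w = vec_of (z + w)"
  by (simp add: vec_eq_iff forall_2)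

lemma vec_of_0 [simp]: "vec_of 0 = 0"
  by (simp add: vec_eq_iff forall_2)

lemma mat_of_vec_of: "mat_of z *v vec_of w = vec_of (z * w)"
  by (simp add: vec_eq_iff forall_2 matrix_vector_mult_def sum_2 algebra_simps)

lemma mat_of_mult: "mat_of z ** mat_of w = mat_of (z * w)"
  by (simp add: vec_eq_iff forall_2 matrix_matrix_mult_def sum_2 algebra_simps)

lemma mat_of_1: "mat_of 1 = mat 1"
  by (simp add: vec_eq_iff forall_2 mat_def)

lemma mat_of_phi: "mat_of phi = A_mat"
  by (simp add: vec_eq_iff forall_2 A_mat_def)

lemma GL_int_sel [simp]:
  "carrier GL_int = {X. invertible X}" "X \<otimes>\<^bsub>GL_int\<^esub> Y = X ** Y" "\<one>\<^bsub>GL_int\<^esub> = mat 1"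
  by (simp_all add: GL_int_def)

lemma group_GL_int: "group (GL_int :: (int ^ 'n ^ 'n) monoid)"
proof (rule groupI)
  fix X assume "X \<in> carrier (GL_int :: (int ^ 'n ^ 'n) monoid)"
  then obtain Y where "X ** Y = mat 1" "Y ** X = mat 1" by (auto simp: invertible_def)
  then show "\<exists>Y\<in>carrier GL_int. Y \<otimes>\<^bsub>GL_int\<^esub> X = \<one>\<^bsub>GL_int\<^esub>" by (auto simp: invertible_def)
qed (auto simp: invertible_mult matrix_mul_assoc invertible_def[of "mat 1"])

lemma A_pow_eq: "A_pow k = mat_of (phi_pow k)"
proof -
  have inv: "A_mat ** mat_of (phi - 1) = mat 1" "mat_of (phi - 1) ** A_mat = mat 1"
    unfolding mat_of_phi[symmetric] mat_of_mult using phi_mult_inverse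
    by (simp_all add: mat_of_1 mult.commute)
  then have A: "A_mat \<in> carrier GL_int" by (auto simp: invertible_def)
  have step: "A_pow (k + 1) = A_mat ** A_pow k" for k
    using group.int_pow_mult[OF group_GL_int A, of 1 k] group.int_pow_1[OF group_GL_int A]
    by (simp add: add.commute)
  have step': "mat_of (phi_pow (k + 1)) = A_mat ** mat_of (phi_pow k)" for k
    by (simp add: phi_pow_add_1 mat_of_phi[symmetric] mat_of_mult)
  show ?thesis
  proof (induction k rule: int_induct[of _ 0])
    case (step2 i)
    have "A_mat ** A_pow (i - 1) = A_mat ** mat_of (phi_pow (i - 1))"
      using step2 step[of "i - 1"] step'[of "i - 1"] by simp
    then have "mat_of (phi - 1) ** (A_mat ** A_pow (i - 1))
        = mat_of (phi - 1) ** (A_mat ** mat_of (phi_pow (i - 1)))" by simp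
    then show ?case by (simp add: matrix_mul_assoc inv)
  qed (simp_all add: mat_of_1 step step')
qed

text \<open>\<open>gam z k\<close> can be read as the affine map w -> phi^k w + z, with composition
  as group law.\<close>

definition gam :: "zphi \<Rightarrow> int \<Rightarrow> (int ^ 2) \<times> int" where "gam z k = (vec_of z, k)"

lemma gam_cases [cases type]: obtains z k where "g = gam z k"
  using vec_of_surj unfolding gam_def by (metis surj_pair)

lemma gam_eq_iff [simp]: "gam z k = gam w l \<longleftrightarrow> z = w \<and> k = l"
  by (simp add: gam_def)

lemma snd_gam [simp]: "snd (gam z k) = k"
  by (simp add: gam_def)

lemma Gamma_group_sel [simp]:
  "carrier Gamma_group = UNIV" "\<one>\<^bsub>Gamma_group\<^esub> = gam 0 0"
  "gam z k \<otimes>\<^bsub>Gamma_group\<^esub> gam w l = gam (z + phi_pow k * w) (k + l)"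
  by (simp_all add: Gamma_group_def gam_def A_pow_eq mat_of_vec_of vec_of_add)

lemma group_Gamma: "group Gamma_group"
proof (rule groupI)
  fix x y z
  show "x \<otimes>\<^bsub>Gamma_group\<^esub> y \<otimes>\<^bsub>Gamma_group\<^esub> z = x \<otimes>\<^bsub>Gamma_group\<^esub> (y \<otimes>\<^bsub>Gamma_group\<^esub> z)"
    by (cases x; cases y; cases z) (simp add: phi_pow_add algebra_simps)
  show "\<one>\<^bsub>Gamma_group\<^esub> \<otimes>\<^bsub>Gamma_group\<^esub> x = x" by (cases x) simp
  show "\<exists>y\<in>carrier Gamma_group. y \<otimes>\<^bsub>Gamma_group\<^esub> x = \<one>\<^bsub>Gamma_group\<^esub>"
  proof (cases x)
    case (1 z k)
    then show ?thesis by (intro bexI[of _ "gam (- phi_pow (- k) * z) (- k)"]) simp_all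
  qed
qed simp_all

lemma inv_gam: "inv\<^bsub>Gamma_group\<^esub> (gam z k) = gam (- phi_pow (- k) * z) (- k)"
  by (rule group.inv_equality[OF group_Gamma]) simp_all

section \<open>The matrix embedding and the congruence subgroups\<close>

lemma Gamma_embed_mult:
  "Gamma_embed (x \<otimes>\<^bsub>Gamma_group\<^esub> y) = Gamma_embed x ** Gamma_embed y"
  by (cases x; cases y)
    (simp add: Gamma_embed_def gam_def[abs_def] Gamma_group_def A_pow_eq mat_of_vec_of phi_pow_add
      vec_eq_iff forall_3 matrix_matrix_mult_def sum_3 algebra_simps)

lemma Gamma_embed_one: "Gamma_embed (gam 0 0) = mat 1"
  by (simp add: Gamma_embed_def gam_def A_pow_eq vec_eq_iff forall_3 mat_def)

lemma invertible_Gamma_embed: "invertible (Gamma_embed x)"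
proof -
  have "x \<otimes>\<^bsub>Gamma_group\<^esub> inv\<^bsub>Gamma_group\<^esub> x = gam 0 0" "inv\<^bsub>Gamma_group\<^esub> x \<otimes>\<^bsub>Gamma_group\<^esub> x = gam 0 0"
    using group.r_inv[OF group_Gamma, of x] group.l_inv[OF group_Gamma, of x] by auto
  then show ?thesis unfolding invertible_def by (metis Gamma_embed_mult Gamma_embed_one)
qed

lemma gam_in_Gamma_cong_iff:
  "gam z k \<in> Gamma_cong N \<longleftrightarrow> of_nat N dvd z \<and> of_nat N dvd phi_pow k - 1"
proof -
  have dvd: "of_nat N dvd w \<longleftrightarrow> int N dvd re w \<and> int N dvd im w" for w
    using of_int_dvd_zphi_iff[of "int N"] by simp
  have "gam z k \<in> Gamma_cong N \<longleftrightarrow>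
      (int N dvd re (phi_pow k) + im (phi_pow k) - 1 \<and> int N dvd im (phi_pow k)
      \<and> int N dvd re (phi_pow k) - 1) \<and> int N dvd im z \<and> int N dvd re z"
    using invertible_Gamma_embed[of "gam z k"]
    by (auto simp: Gamma_cong_def principal_congruence_def Gamma_embed_def gam_def A_pow_eq
        forall_3 mat_def cong_iff_dvd_diff)
  also have "int N dvd re (phi_pow k) + im (phi_pow k) - 1 \<and> int N dvd im (phi_pow k)
      \<and> int N dvd re (phi_pow k) - 1 \<longleftrightarrow> int N dvd re (phi_pow k) - 1 \<and> int N dvd im (phi_pow k)"
    using dvd_add[of "int N" "re (phi_pow k) - 1" "im (phi_pow k)"] by (auto simp: algebra_simps)
  finally show ?thesis unfolding dvd by auto
qed

lemma Gamma_cong_normal: "Gamma_cong N \<lhd> Gamma_group"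
proof -
  interpret group Gamma_group by (rule group_Gamma)
  have mem: "of_nat N dvd phi_pow (k + l) - 1"
    if "of_nat N dvd phi_pow k - 1" "of_nat N dvd phi_pow l - 1" for k l
  proof -
    have "phi_pow (k + l) - 1 = phi_pow k * (phi_pow l - 1) + (phi_pow k - 1)"
      by (simp add: phi_pow_add algebra_simps)
    with that show ?thesis by (simp only: dvd_add dvd_mult)
  qed
  have mem_uminus: "of_nat N dvd phi_pow (- k) - 1" if "of_nat N dvd phi_pow k - 1" for k
  proof -
    have "phi_pow (- k) - 1 = - phi_pow (- k) * (phi_pow k - 1)"
      using phi_pow_uminus[of k] by (simp add: algebra_simps)
    with that show ?thesis by simp
  qed
  have "subgroup (Gamma_cong N) Gamma_group"
  proof (rule subgroupI)
    show "Gamma_cong N \<noteq> {}" using gam_in_Gamma_cong_iff[of 0 0 N] by auto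
    fix a assume a: "a \<in> Gamma_cong N"
    then show "inv\<^bsub>Gamma_group\<^esub> a \<in> Gamma_cong N"
      by (cases a) (simp add: gam_in_Gamma_cong_iff inv_gam mem_uminus)
    fix b assume "b \<in> Gamma_cong N"
    with a show "a \<otimes>\<^bsub>Gamma_group\<^esub> b \<in> Gamma_cong N"
      by (cases a; cases b) (simp add: gam_in_Gamma_cong_iff mem)
  qed simp
  moreover have "x \<otimes>\<^bsub>Gamma_group\<^esub> h \<otimes>\<^bsub>Gamma_group\<^esub> inv\<^bsub>Gamma_group\<^esub> x \<in> Gamma_cong N"
    if "h \<in> Gamma_cong N" for x h
  proof (cases x; cases h)
    fix z k w l assume x: "x = gam z k" and h: "h = gam w l"
    have "phi_pow (k + l) * phi_pow (- k) = phi_pow l"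
      using phi_pow_add[of "k + l" "- k"] by simp
    then have "x \<otimes>\<^bsub>Gamma_group\<^esub> h \<otimes>\<^bsub>Gamma_group\<^esub> inv\<^bsub>Gamma_group\<^esub> x
        = gam (phi_pow k * w - (phi_pow l - 1) * z) l"
      by (simp add: x h inv_gam algebra_simps flip: mult.assoc)
    with that show ?thesis by (simp add: h gam_in_Gamma_cong_iff dvd_diff)
  qed
  ultimately show ?thesis unfolding normal_inv_iff by simp
qed

section \<open>Cosets and indices of the congruence subgroups\<close>

definition gam_mod :: "nat \<Rightarrow> (int ^ 2) \<times> int \<Rightarrow> int \<times> int \<times> int" where
  "gam_mod N = (\<lambda>(v, k). (v $ 1 mod int N, v $ 2 mod int N, k mod int (period N)))"

lemma gam_mod_gam: "gam_mod N (gam z k) = (im z mod int N, re z mod int N, k mod int (period N))"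
  by (simp add: gam_mod_def gam_def)

lemma gam_mod_eq_iff:
  assumes "N > 0"
  shows "gam_mod N (gam z k) = gam_mod N (gam w l)
    \<longleftrightarrow> of_nat N dvd z - w \<and> of_nat N dvd phi_pow (k - l) - 1"
proof -
  have "of_nat N dvd z - w \<longleftrightarrow> int N dvd re z - re w \<and> int N dvd im z - im w"
    using of_int_dvd_zphi_iff[of "int N" "z - w"] by simp
  then show ?thesis unfolding of_nat_dvd_phi_pow_iff[OF assms]
    by (auto simp: gam_mod_gam mod_eq_dvd_iff)
qed

text \<open>Membership asks for phi^(l-k) = 1 and w = phi^(l-k) z modulo N. The first condition
  turns the second into w = z, so translation part and exponent decouple into residues that can be
  counted.\<close>

lemma in_coset_iff:
  assumes "N > 0"
  shows "g \<in> Gamma_cong N #>\<^bsub>Gamma_group\<^esub> x \<longleftrightarrow> gam_mod N g = gam_mod N x"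
proof (cases g; cases x)
  fix w l z k assume g: "g = gam w l" and x: "x = gam z k"
  have "g \<in> Gamma_cong N #>\<^bsub>Gamma_group\<^esub> x \<longleftrightarrow> (\<exists>h. h \<in> Gamma_cong N \<and> g = h \<otimes>\<^bsub>Gamma_group\<^esub> x)"
    by (auto simp: r_coset_def)
  also have "\<dots> \<longleftrightarrow> (\<exists>u j. gam u j \<in> Gamma_cong N \<and> w = u + phi_pow j * z \<and> l = j + k)"
    unfolding g x by (metis gam_cases gam_eq_iff Gamma_group_sel(3))
  also have "\<dots> \<longleftrightarrow> gam (w - phi_pow (l - k) * z) (l - k) \<in> Gamma_cong N"
  proof -
    have "w = u + phi_pow j * z \<and> l = j + k \<longleftrightarrow> u = w - phi_pow (l - k) * z \<and> j = l - k" for u j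
      by auto
    then show ?thesis by simp
  qed
  also have "\<dots> \<longleftrightarrow> of_nat N dvd w - z \<and> of_nat N dvd phi_pow (l - k) - 1"
  proof -
    define y where "y = w - phi_pow (l - k) * z"
    have eq: "w - z = y + z * (phi_pow (l - k) - 1)"
      by (simp add: y_def algebra_simps)
    have "of_nat N dvd y \<longleftrightarrow> of_nat N dvd w - z"
      if "of_nat N dvd phi_pow (l - k) - 1"
      unfolding eq using that by (simp only: dvd_add_left_iff dvd_mult)
    then show ?thesis unfolding gam_in_Gamma_cong_iff y_def by auto
  qed
  also have "\<dots> \<longleftrightarrow> gam_mod N g = gam_mod N x"
    unfolding g x gam_mod_eq_iff[OF assms] by simp
  finally show ?thesis .
qed

lemma range_gam_mod:
  assumes "N > 0"
  shows "range (gam_mod N) = {0..<int N} \<times> {0..<int N} \<times> {0..<int (period N)}"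
proof
  show "range (gam_mod N) \<subseteq> {0..<int N} \<times> {0..<int N} \<times> {0..<int (period N)}"
    using assms period_pos[OF assms] by (auto simp: gam_mod_def)
  show "{0..<int N} \<times> {0..<int N} \<times> {0..<int (period N)} \<subseteq> range (gam_mod N)"
  proof safe
    fix a b c assume "a \<in> {0..<int N}" "b \<in> {0..<int N}" "c \<in> {0..<int (period N)}"
    then have "(a, b, c) = gam_mod N (gam (Zphi b a) c)" by (simp add: gam_mod_gam)
    then show "(a, b, c) \<in> range (gam_mod N)" by blast
  qed
qed

lemma finite_rcosets_and_card:
  assumes "N > 0"
  shows "finite (rcosets\<^bsub>Gamma_group\<^esub> (Gamma_cong N))"
    and "card (rcosets\<^bsub>Gamma_group\<^esub> (Gamma_cong N)) = N * N * period N"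
proof -
  \<comment> \<open>The cosets are the nonempty fibres of \<open>gam_mod N\<close>, so counting them
    means counting its range.\<close>
  define F where "F c = {g. gam_mod N g = c}" for c
  have "Gamma_cong N #>\<^bsub>Gamma_group\<^esub> x = F (gam_mod N x)" for x
    unfolding F_def in_coset_iff[OF assms, symmetric] by simp
  then have eq: "rcosets\<^bsub>Gamma_group\<^esub> (Gamma_cong N) = F ` range (gam_mod N)"
    by (auto simp: RCOSETS_def)
  have "inj_on F (range (gam_mod N))"
  proof (rule inj_onI)
    fix c d assume "c \<in> range (gam_mod N)" "F c = F d"
    then obtain g where "c = gam_mod N g" "g \<in> F d" by (auto simp: F_def)
    then show "c = d" by (simp add: F_def)
  qed
  then show "finite (rcosets\<^bsub>Gamma_group\<^esub> (Gamma_cong N))"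
    "card (rcosets\<^bsub>Gamma_group\<^esub> (Gamma_cong N)) = N * N * period N"
    unfolding eq by (simp_all add: card_image range_gam_mod[OF assms] card_cartesian_product)
qed

text \<open>Strict growth gives N k >= k, so an integer divisible by every N k is 0. This kills the
  translation part of an element of the intersection directly, and its exponent l through N k
  dividing F_|l| for all k.\<close>

lemma congruence_box_iff:
  "congruence_box N \<longleftrightarrow> (\<forall>k\<ge>1. 0 < N k \<and> N k < N (Suc k) \<and> N k dvd N (Suc k))"
proof
  assume N: "\<forall>k\<ge>1. 0 < N k \<and> N k < N (Suc k) \<and> N k dvd N (Suc k)"
  have "g = gam 0 0" if g: "\<forall>k\<ge>1. g \<in> Gamma_cong (N k)" for g
  proof (cases g)
    case (1 z l)
    have ge: "k \<le> N k" if "k \<ge> 1" for k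
      using that
    proof (induction k rule: dec_induct)
      case (step n)
      then show ?case using N by (metis Suc_leI le_less_trans)
    qed (use N in \<open>auto simp: Suc_le_eq\<close>)
    have small: "x = 0" if "\<forall>k\<ge>1. int (N k) dvd x" for x
    proof (rule ccontr)
      define k where "k = Suc (nat \<bar>x\<bar>)"
      assume "x \<noteq> 0"
      moreover have "int (N k) dvd x" using that by (simp add: k_def)
      ultimately have "int (N k) \<le> \<bar>x\<bar>" using dvd_imp_le_int[of x "int (N k)"] by simp
      with ge[of k] show False by (simp add: k_def)
    qed
    have z: "int (N k) dvd re z" "int (N k) dvd im z"
      and l: "of_nat (N k) dvd phi_pow l - 1" if "k \<ge> 1" for k
      using g that of_int_dvd_zphi_iff[of "int (N k)" z] by (auto simp: 1 gam_in_Gamma_cong_iff)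
    have "z = 0" using z small by (intro zphi.expand) auto
    moreover have "l = 0"
    proof (rule ccontr)
      assume "l \<noteq> 0"
      have dvd: "int (N k) dvd int (fib (nat \<bar>l\<bar>))" if "k \<ge> 1" for k
      proof -
        have "int (period (N k)) dvd int (nat \<bar>l\<bar>)"
          using l[OF that] N that by (simp add: of_nat_dvd_phi_pow_iff)
        then have "of_nat (N k) dvd phi ^ nat \<bar>l\<bar> - 1"
          using N that by (metis phi_pow_of_nat of_nat_dvd_phi_pow_iff)
        then show ?thesis using dvd_fib_if_dvd_phi_power by simp
      qed
      then have "int (fib (nat \<bar>l\<bar>)) = 0" using small by blast
      then show False using fib_neq_0_nat[of "nat \<bar>l\<bar>"] \<open>l \<noteq> 0\<close> by simp
    qed
    ultimately show ?thesis by (simp add: 1)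
  qed
  moreover have "gam 0 0 \<in> Gamma_cong (N k)" for k by (simp add: gam_in_Gamma_cong_iff)
  moreover have "Gamma_cong (N (Suc k)) \<subseteq> Gamma_cong (N k)" if "k \<ge> 1" for k
  proof
    fix g assume "g \<in> Gamma_cong (N (Suc k))"
    moreover have "(of_nat (N k) :: zphi) dvd of_nat (N (Suc k))"
      using N that by (metis dvd_def of_nat_mult)
    ultimately show "g \<in> Gamma_cong (N k)"
      by (cases g) (auto simp: gam_in_Gamma_cong_iff intro: dvd_trans)
  qed
  ultimately show "congruence_box N"
    using N unfolding congruence_box_def filtration_def
    by (auto simp: Gamma_cong_normal finite_rcosets_and_card)
qed (simp add: congruence_box_def)

section \<open>Word lengths and diameters of quotients\<close>

text \<open>The ball of radius n around the identity. Unlike \<open>graph_dist\<close>, whose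
  \<open>LEAST\<close> is informative only once a path exists, it is monotone in n and subadditive
  in groups.\<close>

definition word_le :: "('a, 'b) monoid_scheme \<Rightarrow> 'a set \<Rightarrow> nat \<Rightarrow> 'a \<Rightarrow> bool" where
  "word_le G S n g \<longleftrightarrow> (\<exists>k\<le>n. (\<one>\<^bsub>G\<^esub>, g) \<in> cayley_graph G S ^^ k)"

lemma word_le_mono: "word_le G S m g \<Longrightarrow> m \<le> n \<Longrightarrow> word_le G S n g"
  unfolding word_le_def by (meson le_trans)

lemma word_le_one: "word_le G S n \<one>\<^bsub>G\<^esub>"
  unfolding word_le_def by (rule exI[of _ 0]) simp

lemma cayley_power_carrier:
  assumes "(x, y) \<in> cayley_graph G S ^^ n" "x \<in> carrier G"
  shows "y \<in> carrier G"
  using assms by (cases n) (auto simp: cayley_graph_def)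

lemma cayley_power_sym:
  assumes "(x, y) \<in> cayley_graph G S ^^ n"
  shows "(y, x) \<in> cayley_graph G S ^^ n"
  using assms
proof (induction n arbitrary: y)
  case (Suc n)
  then obtain z where z: "(x, z) \<in> cayley_graph G S ^^ n" "(z, y) \<in> cayley_graph G S" by auto
  then have "(y, z) \<in> cayley_graph G S" by (auto simp: cayley_graph_def)
  with Suc.IH[OF z(1)] show ?case by (rule relpow_Suc_I2[rotated])
qed simp

section \<open>Paths and word lengths under translations and quotient maps\<close>

context group
begin

text \<open>Edges multiply on the right, so left multiplication maps edges to edges.\<close>

lemma cayley_power_translate:
  assumes "(x, y) \<in> cayley_graph G S ^^ n" "S \<subseteq> carrier G" "z \<in> carrier G"
  shows "(z \<otimes> x, z \<otimes> y) \<in> cayley_graph G S ^^ n"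
  using assms(1)
proof (induction n arbitrary: y)
  case (Suc n)
  then obtain w where w: "(x, w) \<in> cayley_graph G S ^^ n" "(w, y) \<in> cayley_graph G S" by auto
  from w(2) assms(2,3) have "(z \<otimes> w, z \<otimes> y) \<in> cayley_graph G S"
    by (fastforce simp: cayley_graph_def m_assoc subset_iff)
  with Suc.IH[OF w(1)] show ?case by auto
qed simp

lemma word_le_carrier: "word_le G S n g \<Longrightarrow> g \<in> carrier G"
  by (auto simp: word_le_def intro: cayley_power_carrier[OF _ one_closed])

lemma word_le_mult:
  assumes "word_le G S m g" "word_le G S n h" "S \<subseteq> carrier G"
  shows "word_le G S (m + n) (g \<otimes> h)"
proof -
  have g: "g \<in> carrier G" using assms(1) by (rule word_le_carrier)
  obtain k l where "k \<le> m" "(\<one>, g) \<in> cayley_graph G S ^^ k"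
    and "l \<le> n" and l: "(\<one>, h) \<in> cayley_graph G S ^^ l"
    using assms unfolding word_le_def by blast
  moreover have "(g, g \<otimes> h) \<in> cayley_graph G S ^^ l"
    using cayley_power_translate[OF l assms(3) g] g by simp
  ultimately have "(\<one>, g \<otimes> h) \<in> cayley_graph G S ^^ (k + l)" "k + l \<le> m + n"
    unfolding relpow_add by auto
  then show ?thesis unfolding word_le_def by blast
qed

lemma word_le_inv:
  assumes "word_le G S n g" "S \<subseteq> carrier G"
  shows "word_le G S n (inv g)"
proof -
  have g: "g \<in> carrier G" using assms(1) by (rule word_le_carrier)
  obtain k where k: "k \<le> n" "(\<one>, g) \<in> cayley_graph G S ^^ k"
    using assms unfolding word_le_def by blast
  have "(inv g \<otimes> \<one>, inv g \<otimes> g) \<in> cayley_graph G S ^^ k"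
    using k(2) assms(2) g by (intro cayley_power_translate) auto
  then have "(inv g, \<one>) \<in> cayley_graph G S ^^ k" using g by simp
  then have "(\<one>, inv g) \<in> cayley_graph G S ^^ k" by (rule cayley_power_sym)
  with k(1) show ?thesis unfolding word_le_def by (intro exI[of _ k] conjI)
qed

lemma ex_word_le:
  assumes "generating_set G S" "g \<in> carrier G"
  shows "\<exists>n. word_le G S n g"
proof -
  have S: "S \<subseteq> carrier G" using assms(1) by (simp add: generating_set_def)
  have one_letter: "word_le G S 1 s" if "s \<in> S" for s
  proof -
    have "(\<one>, s) \<in> cayley_graph G S"
      using that S by (auto simp: cayley_graph_def subset_iff intro!: bexI[of _ s])
    then show ?thesis unfolding word_le_def by (intro exI[of _ 1]) simp
  qed
  have "g \<in> generate G S" using assms by (simp add: generating_set_def)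
  then show ?thesis
  proof induction
    case one
    then show ?case using word_le_one by blast
  next
    case (incl s)
    then show ?case using one_letter by blast
  next
    case (inv s)
    then show ?case using one_letter word_le_inv S by blast
  next
    case (eng g h)
    then show ?case using word_le_mult S by blast
  qed
qed

lemma cayley_power_quotient:
  assumes "N \<lhd> G" "S \<subseteq> carrier G" "x \<in> carrier G" "(x, y) \<in> cayley_graph G S ^^ n"
  shows "(N #> x, N #> y) \<in> cayley_graph (G Mod N) ((\<lambda>s. N #> s) ` S) ^^ n"
  using assms(4)
proof (induction n arbitrary: y)
  case (Suc n)
  interpret N: normal N G by fact
  from Suc.prems obtain w where w: "(x, w) \<in> cayley_graph G S ^^ n" "(w, y) \<in> cayley_graph G S"
    by auto
  then have "w \<in> carrier G" "y \<in> carrier G" by (auto simp: cayley_graph_def)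
  with w(2) assms(2) have "(N #> w, N #> y) \<in> cayley_graph (G Mod N) ((\<lambda>s. N #> s) ` S)"
    by (fastforce simp: cayley_graph_def FactGroup_def RCOSETS_def N.rcos_sum subset_iff)
  with Suc.IH[OF w(1)] show ?case by auto
qed simp

text \<open>Quotient paths lift edge by edge without change of length, so a short distance in the
  quotient yields a short representative upstairs.\<close>

lemma cayley_power_lift:
  assumes "N \<lhd> G" "S \<subseteq> carrier G" "x \<in> carrier G"
    and "(N #> x, Y) \<in> cayley_graph (G Mod N) ((\<lambda>s. N #> s) ` S) ^^ n"
  shows "\<exists>y. (x, y) \<in> cayley_graph G S ^^ n \<and> Y = N #> y"
  using assms(4)
proof (induction n arbitrary: Y)
  case 0
  then show ?case by auto
next
  case (Suc n)
  interpret N: normal N G by fact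
  let ?E = "cayley_graph (G Mod N) ((\<lambda>s. N #> s) ` S)"
  from Suc.prems obtain W where W: "(N #> x, W) \<in> ?E ^^ n" "(W, Y) \<in> ?E" by auto
  from Suc.IH[OF W(1)] obtain w where w: "(x, w) \<in> cayley_graph G S ^^ n" "W = N #> w" by blast
  have wc: "w \<in> carrier G" using w(1) assms(3) by (rule cayley_power_carrier)
  from W(2) obtain s y where s: "s \<in> S" "s \<in> carrier G"
    and y: "y \<in> carrier G" "Y = N #> y"
    and "Y = W <#> (N #> s) \<or> W = Y <#> (N #> s)"
    using assms(2) by (auto simp: cayley_graph_def FactGroup_def RCOSETS_def)
  then consider "Y = N #> (w \<otimes> s)" | "N #> w = N #> (y \<otimes> s)"
    using wc by (auto simp: w(2) N.rcos_sum)
  then show ?case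
  proof cases
    case 1
    have "(w, w \<otimes> s) \<in> cayley_graph G S" using s wc by (auto simp: cayley_graph_def)
    with w(1) 1 show ?thesis by auto
  next
    \<comment> \<open>The edge is traversed against its generator, so its lift multiplies by the
      inverse of s.\<close>
    case 2
    have "N #> (w \<otimes> inv s) = (N #> w) #> inv s" using s wc N.subset by (simp add: coset_mult_assoc)
    also have "\<dots> = N #> (y \<otimes> s \<otimes> inv s)" using s y N.subset by (simp add: 2 coset_mult_assoc)
    also have "\<dots> = Y" using s y by (simp add: m_assoc)
    finally have "Y = N #> (w \<otimes> inv s)" by simp
    moreover have "(w, w \<otimes> inv s) \<in> cayley_graph G S"
      using s wc by (auto simp: cayley_graph_def m_assoc intro!: bexI[of _ s])
    ultimately show ?thesis using w(1) by auto
  qed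
qed

text \<open>By translation it is enough that every coset meets the ball of radius B: apply this to
  the coset of x^(-1) y and translate by x.\<close>

lemma graph_dist_quotient_le:
  assumes "N \<lhd> G" "S \<subseteq> carrier G"
    and short: "\<And>g. g \<in> carrier G \<Longrightarrow> \<exists>h\<in>N #> g. word_le G S B h"
    and "X \<in> carrier (G Mod N)" "Y \<in> carrier (G Mod N)"
  shows "graph_dist (cayley_graph (G Mod N) ((\<lambda>s. N #> s) ` S)) X Y \<le> real B"
proof -
  interpret N: normal N G by fact
  obtain x y where x: "x \<in> carrier G" "X = N #> x" and y: "y \<in> carrier G" "Y = N #> y"
    using assms by (auto simp: FactGroup_def RCOSETS_def)
  obtain h where h: "h \<in> N #> (inv x \<otimes> y)" "word_le G S B h" using short[of "inv x \<otimes> y"] x y by auto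
  have hc: "h \<in> carrier G" using h(2) by (rule word_le_carrier)
  obtain k where k: "k \<le> B" "(\<one>, h) \<in> cayley_graph G S ^^ k" using h(2) by (auto simp: word_le_def)
  from cayley_power_translate[OF k(2) assms(2) x(1)]
  have "(x, x \<otimes> h) \<in> cayley_graph G S ^^ k" using x by simp
  from cayley_power_quotient[OF assms(1,2) x(1) this]
  have "(X, N #> (x \<otimes> h)) \<in> cayley_graph (G Mod N) ((\<lambda>s. N #> s) ` S) ^^ k" by (simp add: x)
  moreover have "N #> h = N #> (inv x \<otimes> y)"
    using h(1) x y N.subgroup_axioms by (intro repr_independence[symmetric]) auto
  then have "N #> (x \<otimes> h) = N #> (x \<otimes> (inv x \<otimes> y))"
    using x y hc by (metis N.rcos_sum inv_closed m_closed)
  then have "N #> (x \<otimes> h) = Y" using x y by (simp add: m_assoc[symmetric])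
  ultimately show ?thesis
    unfolding graph_dist_def of_nat_le_iff by (intro le_trans[OF Least_le k(1)]) simp
qed

text \<open>Generation guarantees that the \<open>LEAST\<close> in \<open>graph_dist\<close> is
  attained; a minimal path is then lifted.\<close>

lemma graph_dist_quotient_path:
  assumes "N \<lhd> G" "generating_set G S" "g \<in> carrier G"
  shows "\<exists>n h. graph_dist (cayley_graph (G Mod N) ((\<lambda>s. N #> s) ` S)) (N #> \<one>) (N #> g) = real n
    \<and> (\<one>, h) \<in> cayley_graph G S ^^ n \<and> N #> g = N #> h"
proof -
  let ?E = "cayley_graph (G Mod N) ((\<lambda>s. N #> s) ` S)"
  have S: "S \<subseteq> carrier G" using assms(2) by (simp add: generating_set_def)
  define n where "n = (LEAST n. (N #> \<one>, N #> g) \<in> ?E ^^ n)"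
  obtain k where "(\<one>, g) \<in> cayley_graph G S ^^ k"
    using ex_word_le[OF assms(2,3)] by (auto simp: word_le_def)
  from cayley_power_quotient[OF assms(1) S one_closed this]
  have "(N #> \<one>, N #> g) \<in> ?E ^^ n" unfolding n_def by (rule LeastI)
  from cayley_power_lift[OF assms(1) S one_closed this]
  show ?thesis by (auto simp: graph_dist_def n_def)
qed

end

lemma diam_box_component:
  "diam_of (box_dist G S M) (box_component G M k)
    = diam_of (graph_dist (cayley_graph (G Mod M k) ((\<lambda>s. M k #>\<^bsub>G\<^esub> s) ` S))) (carrier (G Mod M k))"
proof -
  have "(\<lambda>(x, y). box_dist G S M x y) ` (box_component G M k \<times> box_component G M k)
    = (\<lambda>(x, y). graph_dist (cayley_graph (G Mod M k) ((\<lambda>s. M k #>\<^bsub>G\<^esub> s) ` S)) x y)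
      ` (carrier (G Mod M k) \<times> carrier (G Mod M k))"
    by (force simp: box_component_def box_dist_def coarse_union_dist_def)
  then show ?thesis by (simp add: diam_of_def box_component_def)
qed

lemma diam_of_le:
  assumes "X \<noteq> {}" "\<And>x y. x \<in> X \<Longrightarrow> y \<in> X \<Longrightarrow> d x y \<le> B"
  shows "diam_of d X \<le> B"
  using assms unfolding diam_of_def by (auto intro!: cSUP_least)

lemma le_diam_of:
  assumes "finite X" "x \<in> X" "y \<in> X"
  shows "d x y \<le> diam_of d X"
proof -
  have "(case (x, y) of (x, y) \<Rightarrow> d x y) \<le> (SUP (x, y)\<in>X \<times> X. d x y)"
    using assms by (intro cSUP_upper bdd_above_finite) auto
  then show ?thesis using assms by (auto simp: diam_of_def)
qed

section \<open>Diameters of the congruence quotients\<close>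

text \<open>The Lucas numbers L_(2n) of even index. Even powers are needed: phi^2 has norm 1, so its
  inverse is its conjugate and phi^(2n) + phi^(-2n) is a rational integer.\<close>

fun luc :: "nat \<Rightarrow> int" where
  "luc 0 = 2"
| "luc (Suc 0) = 3"
| "luc (Suc (Suc n)) = 3 * luc (Suc n) - luc n"

lemma of_int_luc: "of_int (luc n) = phi_pow (2 * int n) + phi_pow (- (2 * int n))"
proof (induction n rule: luc.induct)
  case (3 n)
  have plus: "phi_pow (2 * int (Suc (Suc n))) = 3 * phi_pow (2 * int (Suc n)) - phi_pow (2 * int n)"
  proof -
    have four: "phi_pow 4 = 3 * phi_pow 2 - 1"
      by (rule zphi.expand) (simp add: phi_pow_def eval_nat_numeral)
    have "phi_pow (2 * int n + 4) = 3 * phi_pow (2 * int n + 2) - phi_pow (2 * int n)"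
      unfolding phi_pow_add four by (simp add: algebra_simps)
    then show ?thesis by (simp add: algebra_simps)
  qed
  have minus: "phi_pow (- (2 * int (Suc (Suc n))))
      = 3 * phi_pow (- (2 * int (Suc n))) - phi_pow (- (2 * int n))"
  proof -
    have four: "phi_pow (-4) = 3 * phi_pow (-2) - 1"
      by (rule zphi.expand) (simp add: phi_pow_def eval_nat_numeral)
    have "phi_pow (- (2 * int n) + - 4)
        = 3 * phi_pow (- (2 * int n) + - 2) - phi_pow (- (2 * int n))"
      unfolding phi_pow_add four by (simp add: algebra_simps)
    then show ?thesis by (simp add: algebra_simps)
  qed
  show ?case using 3 unfolding plus minus by simp
qed (rule zphi.expand; simp add: phi_pow_def eval_nat_numeral)+

text \<open>The ratio bound 3 is what keeps the digits of the greedy expansion at most 2.\<close>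

lemma luc_growth: "0 < luc n \<and> luc n \<le> luc (Suc n) \<and> luc (Suc n) \<le> 3 * luc n"
  by (induction n rule: luc.induct) auto

text \<open>Together with N <= 2^m this puts the residues modulo N below
  \<open>luc m\<close>.\<close>

lemma two_power_le_luc: "2 ^ n \<le> luc n"
proof (induction n rule: luc.induct)
  case (3 n)
  then show ?case using luc_growth[of n] by simp
qed simp_all

text \<open>L bounds the lengths of the unit translation and the unit shift for an arbitrary S; all
  later bounds are multiples of L.\<close>

context
  fixes S L
  assumes S: "S \<subseteq> carrier Gamma_group"
    and base: "word_le Gamma_group S L (gam 1 0)" "word_le Gamma_group S L (gam 0 1)"
begin

lemma word_le_gam_mult:
  assumes "word_le Gamma_group S m (gam z k)" "word_le Gamma_group S n (gam w l)"
  shows "word_le Gamma_group S (m + n) (gam (z + phi_pow k * w) (k + l))"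
  using group.word_le_mult[OF group_Gamma assms S] by simp

lemma word_le_translation_nat: "word_le Gamma_group S (n * L) (gam (of_nat n) 0)"
proof (induction n)
  case 0
  show ?case using word_le_one[of Gamma_group S 0] by simp
next
  case (Suc n)
  then show ?case using word_le_gam_mult[OF base(1) Suc.IH] by simp
qed

lemma word_le_shift: "word_le Gamma_group S (nat \<bar>k\<bar> * L) (gam 0 k)"
proof -
  have nat: "word_le Gamma_group S (n * L) (gam 0 (int n))" for n
  proof (induction n)
    case 0
    show ?case using word_le_one[of Gamma_group S 0] by simp
  next
    case (Suc n)
    then show ?case using word_le_gam_mult[OF base(2) Suc.IH] by (simp add: add.commute)
  qed
  show ?thesis
  proof (cases k rule: int_cases2)
    case (nonpos n)
    then show ?thesis using group.word_le_inv[OF group_Gamma nat[of n] S] by (simp add: inv_gam)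
  qed (use nat in simp)
qed

text \<open>Expanding an integer greedily in base \<open>\<phi>\<^bsup>2n\<^esup> + \<phi>\<^bsup>-2n\<^esup>\<close> and collecting positive and negative powers
  separately, the digits can be spelled out while walking along the powers of \<open>\<phi>\<^sup>2\<close>.\<close>

lemma word_le_luc_expansion:
  assumes "0 \<le> x" "x < luc n"
  shows "\<exists>u w. u + w = of_int x \<and> word_le Gamma_group S ((4 * n + 1) * L) (gam u (2 * int n))
    \<and> word_le Gamma_group S ((4 * n + 1) * L) (gam w (- (2 * int n)))"
  using assms
proof (induction n arbitrary: x)
  case 0
  then have "nat x \<le> 1" "(of_nat (nat x) :: zphi) = of_int x" by (simp_all add: of_nat_nat)
  then have "word_le Gamma_group S L (gam (of_int x) 0)"
    using word_le_mono[OF word_le_translation_nat[of "nat x"], of L] by simp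
  then show ?case using word_le_one[of Gamma_group S L] by (intro exI[of _ "of_int x"] exI[of _ 0]) simp
next
  case (Suc n)
  define q r where "q = nat (x div luc n)" and "r = x mod luc n"
  have pos: "luc n > 0" "luc (Suc n) \<le> 3 * luc n" using luc_growth[of n] by auto
  have r: "0 \<le> r" "r < luc n" using pos by (simp_all add: r_def)
  have "luc n * (x div luc n) \<le> x"
    using r(1) mult_div_mod_eq[of "luc n" x] unfolding r_def by linarith
  with Suc.prems pos have "luc n * (x div luc n) < luc n * 3" by linarith
  with pos have "x div luc n < 3" by simp
  then have q: "q \<le> 2" by (simp add: q_def)
  have "x div luc n \<ge> 0" using Suc.prems pos by (simp add: pos_imp_zdiv_nonneg_iff)
  then have x: "x = r + int q * luc n" by (simp add: q_def r_def mult.commute)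
  obtain u w where uw: "u + w = of_int r"
    "word_le Gamma_group S ((4 * n + 1) * L) (gam u (2 * int n))"
    "word_le Gamma_group S ((4 * n + 1) * L) (gam w (- (2 * int n)))"
    using Suc.IH[OF r] by blast
  \<comment> \<open>Each level costs 2L for the digit and 2L for the move by phi^2 or its inverse,
    whence the 4 in (4n + 1)L.\<close>
  have digit: "word_le Gamma_group S (2 * L) (gam (of_nat q) 0)"
    using word_le_translation_nat by (rule word_le_mono) (use q in simp)
  have "word_le Gamma_group S ((4 * n + 1) * L + 2 * L + 2 * L)
      (gam (u + phi_pow (2 * int n) * of_nat q) (2 * int n + 2))"
    using word_le_gam_mult[OF word_le_gam_mult[OF uw(2) digit] word_le_shift[of 2]] by simp
  moreover have "word_le Gamma_group S ((4 * n + 1) * L + 2 * L + 2 * L)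
      (gam (w + phi_pow (- (2 * int n)) * of_nat q) (- (2 * int n) + (- 2)))"
    using word_le_gam_mult[OF word_le_gam_mult[OF uw(3) digit] word_le_shift[of "-2"]] by simp
  moreover have "of_int x = (u + phi_pow (2 * int n) * of_nat q) + (w + phi_pow (- (2 * int n)) * of_nat q)"
    by (simp add: x uw(1)[symmetric] of_int_luc algebra_simps)
  moreover have "(4 * n + 1) * L + 2 * L + 2 * L = (4 * Suc n + 1) * L" by (simp add: algebra_simps)
  ultimately show ?case
    by (intro exI[of _ "u + phi_pow (2 * int n) * of_nat q"]
        exI[of _ "w + phi_pow (- (2 * int n)) * of_nat q"]) (simp add: algebra_simps)
qed

lemma word_le_integer:
  assumes "0 \<le> x" "x < luc n"
  shows "word_le Gamma_group S ((12 * n + 2) * L) (gam (of_int x) 0)"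
proof -
  obtain u w where uw: "u + w = of_int x"
    "word_le Gamma_group S ((4 * n + 1) * L) (gam u (2 * int n))"
    "word_le Gamma_group S ((4 * n + 1) * L) (gam w (- (2 * int n)))"
    using word_le_luc_expansion[OF assms] by blast
  \<comment> \<open>Returning to exponent 0 costs 2nL, so each half costs (6n + 1)L and both cost
    (12n + 2)L.\<close>
  have "word_le Gamma_group S ((4 * n + 1) * L + 2 * n * L) (gam u 0)"
    using word_le_gam_mult[OF uw(2) word_le_shift[of "- (2 * int n)"]] by (simp add: nat_mult_distrib)
  moreover have "word_le Gamma_group S ((4 * n + 1) * L + 2 * n * L) (gam w 0)"
    using word_le_gam_mult[OF uw(3) word_le_shift[of "2 * int n"]] by (simp add: nat_mult_distrib)
  ultimately show ?thesis
    using word_le_gam_mult[of _ u 0 _ w 0] by (fastforce simp: uw(1) algebra_simps)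
qed

lemma word_le_residue:
  assumes "0 \<le> x" "x < luc m" "0 \<le> y" "y < luc m" "0 \<le> k" "k < int m"
  shows "word_le Gamma_group S (31 * L * m) (gam (Zphi x y) k)"
proof -
  note x = word_le_integer[OF assms(1,2)] and y = word_le_integer[OF assms(3,4)]
  have z: "Zphi x y = of_int x + phi * of_int y" by (rule zphi.expand) simp
  \<comment> \<open>Spell x, shift by 1, spell y, shift back, then shift by k. The total (24m + 6 +
    k)L is at most 31mL because k <= m and m >= 1.\<close>
  have "word_le Gamma_group S ((12 * m + 2) * L + L + (12 * m + 2) * L + L + nat k * L) (gam (Zphi x y) k)"
    using word_le_gam_mult[OF word_le_gam_mult[OF word_le_gam_mult[OF word_le_gam_mult[OF x
      word_le_shift[of 1]] y] word_le_shift[of "-1"]] word_le_shift[of k]] assms(5)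
    by (simp add: z)
  then show ?thesis
  proof (rule word_le_mono)
    have "nat k \<le> m" "1 \<le> m" using assms by auto
    then have "(24 * m + 6 + nat k) * L \<le> (31 * m) * L" by (intro mult_le_mono1) simp
    then show "(12 * m + 2) * L + L + (12 * m + 2) * L + L + nat k * L \<le> 31 * L * m"
      by (simp add: algebra_simps)
  qed
qed

end

lemma diam_congruence_quotient_le:
  assumes "generating_set Gamma_group S"
  shows "\<exists>C>0. \<forall>M N m k. M k = Gamma_cong N \<and> 0 < N \<and> 0 < m \<and> of_nat N dvd phi ^ m - 1 \<longrightarrow>
    diam_of (box_dist Gamma_group S M) (box_component Gamma_group M k) \<le> C * real m"
proof -
  interpret group Gamma_group by (rule group_Gamma)
  have S: "S \<subseteq> carrier Gamma_group" using assms by (simp add: generating_set_def)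
  obtain L1 L2 where "word_le Gamma_group S L1 (gam 1 0)" "word_le Gamma_group S L2 (gam 0 1)"
    using ex_word_le[OF assms, of "gam 1 0"] ex_word_le[OF assms, of "gam 0 1"] by auto
  then have base: "word_le Gamma_group S (L1 + L2 + 1) (gam 1 0)"
      "word_le Gamma_group S (L1 + L2 + 1) (gam 0 1)"
    using word_le_mono by (metis le_add1 add.assoc, metis le_add1 le_add2 le_trans add.assoc)
  define B where "B = 31 * (L1 + L2 + 1)"
  have "diam_of (box_dist Gamma_group S M) (box_component Gamma_group M k) \<le> real B * real m"
    if M: "M k = Gamma_cong N" and N: "0 < N" and m: "0 < m" "of_nat N dvd phi ^ m - 1" for M N m k
  proof -
    have per: "int (period N) dvd int m"
      using of_nat_dvd_phi_pow_iff[OF N, of "int m"] m(2) by (simp add: phi_pow_of_nat)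
    have "int N \<le> 2 ^ m" using le_two_power_if_dvd_phi_power[OF m(2,1)] by (simp flip: of_nat_le_iff)
    then have NL: "int N \<le> luc m" using two_power_le_luc[of m] by linarith
    have short: "\<exists>h\<in>Gamma_cong N #>\<^bsub>Gamma_group\<^esub> g. word_le Gamma_group S (B * m) h" for g
    proof (cases g)
      case (1 z l)
      \<comment> \<open>As m is a multiple of the period, reducing the exponent modulo m stays in
        the coset.\<close>
      define h where "h = gam (Zphi (re z mod int N) (im z mod int N)) (l mod int m)"
      have "gam_mod N h = gam_mod N g"
        using per by (simp add: h_def 1 gam_mod_gam mod_mod_cancel)
      then have "h \<in> Gamma_cong N #>\<^bsub>Gamma_group\<^esub> g" using in_coset_iff[OF N] by blast
      moreover have "word_le Gamma_group S (B * m) h"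
        unfolding h_def B_def using N m(1) NL
        by (intro word_le_residue[OF S base]) (auto intro: less_le_trans[OF pos_mod_bound])
      ultimately show ?thesis by blast
    qed
    have "carrier (Gamma_group Mod Gamma_cong N) \<noteq> {}" by (simp add: FactGroup_def RCOSETS_def)
    then have "diam_of (graph_dist (cayley_graph (Gamma_group Mod Gamma_cong N)
        ((\<lambda>s. Gamma_cong N #>\<^bsub>Gamma_group\<^esub> s) ` S))) (carrier (Gamma_group Mod Gamma_cong N)) \<le> real (B * m)"
      using graph_dist_quotient_le[OF Gamma_cong_normal S short] by (intro diam_of_le)
    then show ?thesis unfolding diam_box_component M by simp
  qed
  moreover have "real B > 0" by (simp add: B_def)
  ultimately show ?thesis by blast
qed

lemma diam_congruence_quotient_ge:
  assumes "finite S" "generating_set Gamma_group S"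
  shows "\<exists>C>0. \<forall>M N k d. M k = Gamma_cong N \<and> 0 < N \<and> d dvd period N \<longrightarrow>
    real ((d - 1) div 2) \<le> C * diam_of (box_dist Gamma_group S M) (box_component Gamma_group M k)"
proof -
  interpret group Gamma_group by (rule group_Gamma)
  define c :: int where "c = 1 + (\<Sum>s\<in>S. \<bar>snd s\<bar>)"
  have c: "c > 0" unfolding c_def by (smt (verit) sum_nonneg abs_ge_zero)
  have letter: "\<bar>snd s\<bar> \<le> c" if "s \<in> S" for s
    using member_le_sum[OF that _ assms(1), of "\<lambda>s. \<bar>snd s\<bar>"] by (simp add: c_def)
  have lip: "\<bar>snd h\<bar> \<le> c * int n" if "(\<one>\<^bsub>Gamma_group\<^esub>, h) \<in> cayley_graph Gamma_group S ^^ n" for h n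
    using that
  proof (induction n arbitrary: h)
    case (Suc n)
    then obtain g where g: "(\<one>\<^bsub>Gamma_group\<^esub>, g) \<in> cayley_graph Gamma_group S ^^ n"
      "(g, h) \<in> cayley_graph Gamma_group S" by auto
    have snd_mult: "snd (x \<otimes>\<^bsub>Gamma_group\<^esub> y) = snd x + snd y" for x y
      by (cases x; cases y) simp
    obtain s where "s \<in> S" "h = g \<otimes>\<^bsub>Gamma_group\<^esub> s \<or> g = h \<otimes>\<^bsub>Gamma_group\<^esub> s"
      using g(2) by (auto simp: cayley_graph_def)
    then have "s \<in> S" "snd h = snd g + snd s \<or> snd g = snd h + snd s"
      using snd_mult[of g s] snd_mult[of h s] by auto
    then have "\<bar>snd h\<bar> \<le> \<bar>snd g\<bar> + c" using letter[of s] by linarith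
    then show ?case using Suc.IH[OF g(1)] by (simp add: algebra_simps)
  qed simp
  have "real ((d - 1) div 2) \<le> c * diam_of (box_dist Gamma_group S M) (box_component Gamma_group M k)"
    if M: "M k = Gamma_cong N" and N: "0 < N" and d: "d dvd period N" for M N k d
  proof -
    let ?Q = "Gamma_group Mod Gamma_cong N"
    let ?d = "graph_dist (cayley_graph ?Q ((\<lambda>s. Gamma_cong N #>\<^bsub>Gamma_group\<^esub> s) ` S))"
    \<comment> \<open>A point about half way round Z/d: as 2j < d, every integer congruent to j
      modulo d has absolute value at least j.\<close>
    define j where "j = (d - 1) div 2"
    define X Y where "X = Gamma_cong N #>\<^bsub>Gamma_group\<^esub> \<one>\<^bsub>Gamma_group\<^esub>"
      and "Y = Gamma_cong N #>\<^bsub>Gamma_group\<^esub> gam 0 (int j)"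
    have d_pos: "d > 0" using d period_pos[OF N] by (auto intro: gr0I)
    have j: "2 * j < d" using d_pos by (auto simp: j_def)
    obtain n h where n: "?d X Y = real n"
      and path: "(\<one>\<^bsub>Gamma_group\<^esub>, h) \<in> cayley_graph Gamma_group S ^^ n"
      and h: "Y = Gamma_cong N #>\<^bsub>Gamma_group\<^esub> h"
      using graph_dist_quotient_path[OF Gamma_cong_normal assms(2), of "gam 0 (int j)" N]
      unfolding X_def Y_def by auto
    have "h \<in> Y" unfolding h using in_coset_iff[OF N] by blast
    then have "gam_mod N h = gam_mod N (gam 0 (int j))" unfolding Y_def using in_coset_iff[OF N] by blast
    then have "snd h mod int (period N) = int j mod int (period N)"
      by (cases h) (simp add: gam_mod_gam)
    then have "int (period N) dvd snd h - int j" by (simp add: mod_eq_dvd_iff)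
    then have "int d dvd snd h - int j" using d by (meson dvd_trans int_dvd_int_iff)
    then obtain q where q: "snd h = int j + int d * q" by (metis add_diff_cancel_left' dvdE diff_add_cancel add.commute)
    have "int j \<le> \<bar>snd h\<bar>"
    proof (cases "q \<ge> 0")
      case True
      then have "int d * q \<ge> 0" by simp
      then show ?thesis unfolding q by linarith
    next
      case False
      then have "int d * q \<le> int d * (-1)" by (intro mult_left_mono) auto
      then show ?thesis unfolding q using j by linarith
    qed
    with lip[OF path] have "int j \<le> c * int n" by linarith
    then have "real_of_int (int j) \<le> real_of_int (c * int n)" by (simp only: of_int_le_iff)
    then have "real j \<le> c * ?d X Y" using n by simp
    also have "?d X Y \<le> diam_of ?d (carrier ?Q)"
      unfolding FactGroup_def X_def Y_def using finite_rcosets_and_card(1)[OF N]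
      by (intro le_diam_of) (simp_all add: rcosetsI)
    finally show ?thesis using c unfolding diam_box_component M j_def by simp
  qed
  moreover have "real_of_int c > 0" using c by simp
  ultimately show ?thesis by blast
qed

lemma card_box_component_Gamma:
  assumes "M k = Gamma_cong N" "N > 0"
  shows "card (box_component Gamma_group M k) = N * N * period N"
  using finite_rcosets_and_card(2)[OF assms(2)]
  by (simp add: box_component_def card_cartesian_product FactGroup_def assms(1))

lemma Gamma_cong_proper:
  assumes "N > 1"
  shows "Gamma_cong N \<noteq> carrier Gamma_group"
proof
  assume "Gamma_cong N = carrier Gamma_group"
  then have "gam 1 0 \<in> Gamma_cong N" by simp
  then have "of_int (int N) dvd (1 :: zphi)" by (simp add: gam_in_Gamma_cong_iff)
  with assms show False unfolding of_int_dvd_zphi_iff by simp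
qed

section \<open>Property D of congruence box spaces\<close>

lemma property_D_five_powers:
  assumes "finite S" "generating_set Gamma_group S"
  shows "property_D (1 / 3) Gamma_group S (\<lambda>k. Gamma_cong (5 ^ k))"
proof -
  let ?M = "\<lambda>k. Gamma_cong (5 ^ k)"
  obtain C where C: "C > 0" and ge: "\<And>k d. d dvd period (5 ^ k) \<Longrightarrow>
      real ((d - 1) div 2) \<le> C * diam_of (box_dist Gamma_group S ?M) (box_component Gamma_group ?M k)"
    using diam_congruence_quotient_ge[OF assms] by (metis zero_less_numeral zero_less_power)
  have "1 / (5 * C) * real (card (box_component Gamma_group ?M k)) powr (1 / 3)
      \<le> diam_of (box_dist Gamma_group S ?M) (box_component Gamma_group ?M k)" if "k \<ge> 1" for k
  proof -
    have card: "card (box_component Gamma_group ?M k) = 5 ^ k * 5 ^ k * period (5 ^ k)"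
      by (rule card_box_component_Gamma) simp_all
    \<comment> \<open>The bound 8N on the period makes the right side a perfect cube.\<close>
    have "card (box_component Gamma_group ?M k) \<le> 5 ^ k * 5 ^ k * (8 * 5 ^ k)"
      unfolding card by (intro mult_le_mono2 period_le) simp
    also have "\<dots> = (2 * 5 ^ k) ^ 3" by (simp add: power3_eq_cube)
    finally have "real (card (box_component Gamma_group ?M k)) \<le> real ((2 * 5 ^ k) ^ 3)"
      by (simp only: of_nat_le_iff)
    then have "real (card (box_component Gamma_group ?M k)) powr (1 / 3)
        \<le> real ((2 * 5 ^ k) ^ 3) powr (1 / 3)" by (intro powr_mono2) auto
    also have "\<dots> = ((2 * 5 ^ k) powr 3) powr (1 / 3)" by (simp add: powr_numeral)
    also have "\<dots> = 2 * 5 ^ k" unfolding powr_powr by simp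
    finally have "real (card (box_component Gamma_group ?M k)) powr (1 / 3) \<le> 2 * 5 ^ k" .
    \<comment> \<open>For odd x >= 5 one has 2x <= 5 (x - 1)/2, with equality at 5; hence the 5 in
      1/(5C).\<close>
    moreover have "2 * 5 ^ k \<le> 5 * real ((5 ^ k - 1) div 2)"
    proof -
      have "(5::nat) \<le> 5 ^ k" using that self_le_power[of "5::nat" k] by simp
      moreover have "odd ((5::nat) ^ k)" by simp
      moreover have "2 * x \<le> 5 * ((x - 1) div 2)" if "5 \<le> x" "odd x" for x :: nat
        using that by presburger
      ultimately have "2 * 5 ^ k \<le> 5 * ((5 ^ k - 1) div 2 :: nat)" by blast
      then have "real (2 * 5 ^ k) \<le> real (5 * ((5 ^ k - 1) div 2))" by (simp only: of_nat_le_iff)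
      then show ?thesis by (simp only: of_nat_mult of_nat_power of_nat_numeral)
    qed
    ultimately have "real (card (box_component Gamma_group ?M k)) powr (1 / 3)
        \<le> 5 * (C * diam_of (box_dist Gamma_group S ?M) (box_component Gamma_group ?M k))"
      using ge[OF five_power_dvd_period, of k] by linarith
    with C show ?thesis by (simp add: field_simps)
  qed
  moreover have "1 / (5 * C) > 0" using C by simp
  ultimately show ?thesis unfolding property_D_def by blast
qed

text \<open>With n = N k and p its period, property D gives K (n^2 p)^alpha <= C p. Dividing by
  p^alpha and using p <= 8n and alpha <= 1 bounds n^(3 alpha - 1), which is impossible for a
  positive exponent because N k >= k.\<close>

lemma property_D_exponent_le:
  assumes "generating_set Gamma_group S" "congruence_box N" "\<alpha> \<in> {0<..1}"
    and D: "property_D \<alpha> Gamma_group S (\<lambda>k. Gamma_cong (N k))"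
  shows "\<alpha> \<le> 1 / 3"
proof (rule ccontr)
  let ?M = "\<lambda>k. Gamma_cong (N k)"
  assume "\<not> \<alpha> \<le> 1 / 3"
  define \<beta> where "\<beta> = 3 * \<alpha> - 1"
  have \<beta>: "\<beta> > 0" using \<open>\<not> \<alpha> \<le> 1 / 3\<close> by (simp add: \<beta>_def)
  have N: "0 < N k" "N k < N (Suc k)" if "k \<ge> 1" for k
    using assms(2) that by (auto simp: congruence_box_def)
  have N_ge: "k \<le> N k" if "k \<ge> 1" for k
    using that
  proof (induction k rule: dec_induct)
    case (step n)
    then show ?case using N(2)[of n] by simp
  qed (use N(1) in \<open>auto simp: Suc_le_eq\<close>)
  obtain C where C: "C > 0" and le: "\<And>m k. k \<ge> 1 \<Longrightarrow> 0 < m \<Longrightarrow> of_nat (N k) dvd phi ^ m - 1 \<Longrightarrow>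
      diam_of (box_dist Gamma_group S ?M) (box_component Gamma_group ?M k) \<le> C * real m"
    using diam_congruence_quotient_le[OF assms(1)] N(1) by metis
  obtain K where K: "K > 0" and ge: "\<And>k. k \<ge> 1 \<Longrightarrow> ?M k \<noteq> carrier Gamma_group \<Longrightarrow>
      K * real (card (box_component Gamma_group ?M k)) powr \<alpha>
        \<le> diam_of (box_dist Gamma_group S ?M) (box_component Gamma_group ?M k)"
    using D unfolding property_D_def by blast
  \<comment> \<open>Starting at 2 guarantees N k > 1; N 1 may be 1, and then property D says nothing
    about that component.\<close>
  have bound: "real k powr \<beta> \<le> 8 * C / K" if k: "k \<ge> 2" for k
  proof -
    define n p where "n = real (N k)" and "p = real (period (N k))"
    have k1: "k \<ge> 1" using k by simp
    have Nk: "N k > 1" using N_ge[OF k1] k by simp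
    have n: "n \<ge> 1" and p: "p > 0" "p \<le> 8 * n"
      using Nk period_pos[of "N k"] period_le[of "N k"] by (auto simp: n_def p_def)
    have card: "real (card (box_component Gamma_group ?M k)) = n * n * p"
      using card_box_component_Gamma[of ?M k "N k"] Nk by (simp add: n_def p_def)
    have "K * (n * n * p) powr \<alpha> \<le> diam_of (box_dist Gamma_group S ?M) (box_component Gamma_group ?M k)"
      using ge[OF k1 Gamma_cong_proper[OF Nk]] unfolding card .
    also have "\<dots> \<le> C * p"
      unfolding p_def using Nk by (intro le k1 period_pos period_dvd) simp_all
    finally have "K * (n * n * p) powr \<alpha> \<le> C * p" .
    moreover have "(n * n * p) powr \<alpha> = n powr (2 * \<alpha>) * p powr \<alpha>"
      using n p powr_add[of n \<alpha> \<alpha>] by (simp add: powr_mult)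
    moreover have "p = p powr (1 - \<alpha>) * p powr \<alpha>" using p by (simp flip: powr_add)
    ultimately have "(K * n powr (2 * \<alpha>)) * p powr \<alpha> \<le> (C * p powr (1 - \<alpha>)) * p powr \<alpha>"
      by (metis mult.assoc)
    then have "K * n powr (2 * \<alpha>) \<le> C * p powr (1 - \<alpha>)"
      by (rule mult_right_le_imp_le) (use p in simp)
    also have "p powr (1 - \<alpha>) \<le> 8 * n powr (1 - \<alpha>)"
    proof -
      have "p powr (1 - \<alpha>) \<le> (8 * n) powr (1 - \<alpha>)"
        using p assms(3) by (intro powr_mono2) auto
      also have "\<dots> = 8 powr (1 - \<alpha>) * n powr (1 - \<alpha>)"
        using n by (simp add: powr_mult)
      also have "\<dots> \<le> 8 powr 1 * n powr (1 - \<alpha>)"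
        using assms(3) by (intro mult_right_mono powr_mono) auto
      finally show ?thesis by simp
    qed
    finally have "K * n powr (2 * \<alpha>) \<le> C * (8 * n powr (1 - \<alpha>))" using C by simp
    moreover have "n powr (2 * \<alpha>) = n powr \<beta> * n powr (1 - \<alpha>)"
      by (simp add: \<beta>_def powr_add[symmetric])
    ultimately have "(K * n powr \<beta>) * n powr (1 - \<alpha>) \<le> (8 * C) * n powr (1 - \<alpha>)"
      by (simp add: algebra_simps)
    then have "K * n powr \<beta> \<le> 8 * C" by (rule mult_right_le_imp_le) (use n in simp)
    then have "n powr \<beta> \<le> 8 * C / K" using K by (simp add: field_simps)
    moreover have "real k powr \<beta> \<le> n powr \<beta>"
      using N_ge[OF k1] \<beta> by (intro powr_mono2) (auto simp: n_def)
    ultimately show ?thesis by linarith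
  qed
  have "filterlim (\<lambda>k. real k powr \<beta>) at_top sequentially" using \<beta> by real_asymp
  then have "eventually (\<lambda>k. real k powr \<beta> > 8 * C / K) sequentially"
    unfolding filterlim_at_top_dense by blast
  with eventually_ge_at_top[of 2] have "eventually (\<lambda>k :: nat. False) sequentially"
  proof eventually_elim
    case (elim k)
    with bound[of k] show ?case by simp
  qed
  then show False by simp
qed

lemma two_power_le_fib: "2 ^ n \<le> fib (2 * Suc n)"
proof (induction n)
  case (Suc n)
  then show ?case using fib_Suc_mono[of "2 * Suc n"] by simp
qed (simp add: eval_nat_numeral)

text \<open>Doubling the index makes each term divide the next, by gcd(F_a, F_b) = F_gcd(a,b).
  Starting from F_4 = 3 keeps every level above 1.\<close>

lemma congruence_box_fib: "congruence_box (\<lambda>k. fib (2 ^ Suc k))"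
  unfolding congruence_box_iff
proof (intro allI impI conjI)
  fix k :: nat assume k: "k \<ge> 1"
  define n where "n = (2::nat) ^ k"
  have n: "n \<ge> 2" using k self_le_power[of "2::nat" k] by (simp add: n_def)
  show "0 < fib (2 ^ Suc k)" by (intro fib_neq_0_nat) simp
  have "gcd (2 ^ Suc k) (2 ^ Suc (Suc k)) = (2::nat) ^ Suc k" by simp
  then show "fib (2 ^ Suc k) dvd fib (2 ^ Suc (Suc k))" by (metis fib_gcd gcd_dvd2)
  have "fib (2 * n) < fib (2 * n) + fib (2 * n + 1)" by (simp add: fib_neq_0_nat)
  also have "\<dots> = fib (2 * n + 2)" by simp
  also have "\<dots> \<le> fib (2 * (2 * n))" using n by (intro fib_mono) simp
  finally show "fib (2 ^ Suc k) < fib (2 ^ Suc (Suc k))" by (simp add: n_def)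
qed

text \<open>With x = 2^k, the level F_(2x) and hence the component size is at least 2^(x-1), while
  the exponent 4 * 2x bounds the diameter by 8Cx. A positive power of an exponential outgrows a
  linear function.\<close>

lemma not_property_D_fib:
  assumes "generating_set Gamma_group S" "\<alpha> > 0"
  shows "\<not> property_D \<alpha> Gamma_group S (\<lambda>k. Gamma_cong (fib (2 ^ Suc k)))"
proof
  let ?M = "\<lambda>k. Gamma_cong (fib (2 ^ Suc k))"
  assume D: "property_D \<alpha> Gamma_group S ?M"
  have pos: "0 < fib (2 ^ Suc k)" for k by (intro fib_neq_0_nat) simp
  obtain C where C: "C > 0" and le: "\<And>m k. 0 < m \<Longrightarrow> of_nat (fib (2 ^ Suc k)) dvd phi ^ m - 1 \<Longrightarrow>
      diam_of (box_dist Gamma_group S ?M) (box_component Gamma_group ?M k) \<le> C * real m"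
    using diam_congruence_quotient_le[OF assms(1)] pos by metis
  obtain K where K: "K > 0" and ge: "\<And>k. k \<ge> 1 \<Longrightarrow> ?M k \<noteq> carrier Gamma_group \<Longrightarrow>
      K * real (card (box_component Gamma_group ?M k)) powr \<alpha>
        \<le> diam_of (box_dist Gamma_group S ?M) (box_component Gamma_group ?M k)"
    using D unfolding property_D_def by blast
  have bound: "K * (2 powr (2 ^ k - 1)) powr \<alpha> \<le> C * (8 * 2 ^ k)" if k: "k \<ge> 1" for k
  proof -
    define N where "N = fib (2 ^ Suc k)"
    have k2: "2 \<le> (2::nat) ^ k" using k self_le_power[of "2::nat" k] by simp
    have "2 ^ (2 ^ k - 1) \<le> N"
      using two_power_le_fib[of "2 ^ k - 1"] k2 by (simp add: N_def)
    moreover have "(2::nat) \<le> 2 ^ (2 ^ k - 1)"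
      using k2 self_le_power[of "2::nat" "2 ^ k - 1"] by simp
    ultimately have N: "2 ^ (2 ^ k - 1) \<le> N" "1 < N" by auto
    have "N * 1 * 1 \<le> N * N * period N"
      using N period_pos[of N] by (intro mult_le_mono) auto
    also have "\<dots> = card (box_component Gamma_group ?M k)"
      using card_box_component_Gamma[of ?M k N] N by (simp add: N_def)
    finally have "2 ^ (2 ^ k - 1) \<le> card (box_component Gamma_group ?M k)" using N by simp
    then have "real (2 ^ (2 ^ k - 1)) \<le> real (card (box_component Gamma_group ?M k))"
      by (simp only: of_nat_le_iff)
    also have "real (2 ^ (2 ^ k - 1)) = 2 powr (2 ^ k - 1)"
      using k2 by (simp add: powr_realpow[symmetric] of_nat_diff)
    finally have "(2 powr (2 ^ k - 1)) powr \<alpha> \<le> real (card (box_component Gamma_group ?M k)) powr \<alpha>"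
      using assms(2) by (intro powr_mono2) auto
    then have "K * (2 powr (2 ^ k - 1)) powr \<alpha> \<le> K * real (card (box_component Gamma_group ?M k)) powr \<alpha>"
      using K by simp
    also have "\<dots> \<le> diam_of (box_dist Gamma_group S ?M) (box_component Gamma_group ?M k)"
      using ge[OF k] Gamma_cong_proper N(2) unfolding N_def by blast
    also have "\<dots> \<le> C * real (4 * 2 ^ Suc k)" by (intro le fib_dvd_phi_power) simp_all
    finally show ?thesis by simp
  qed
  have "filterlim (\<lambda>x::real. K * (2 powr (x - 1)) powr \<alpha> - C * (8 * x)) at_top at_top"
    using K C assms(2) by real_asymp
  moreover have "filterlim (\<lambda>k. (2::real) ^ k) at_top sequentially" by real_asymp
  ultimately have "filterlim (\<lambda>k. K * (2 powr (2 ^ k - 1)) powr \<alpha> - C * (8 * 2 ^ k)) at_top sequentially"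
    by (rule filterlim_compose)
  then have "eventually (\<lambda>k. K * (2 powr (2 ^ k - 1)) powr \<alpha> - C * (8 * 2 ^ k) > 0) sequentially"
    unfolding filterlim_at_top_dense by blast
  with eventually_ge_at_top[of 1] have "eventually (\<lambda>k :: nat. False) sequentially"
  proof eventually_elim
    case (elim k)
    with bound[of k] show ?case by simp
  qed
  then show False by simp
qed

theorem proposition8:
  fixes S :: "((int ^ 2) \<times> int) set"
  assumes "finite S" and "generating_set Gamma_group S"
  shows "(congruence_box (\<lambda>k. 5 ^ k) \<and> property_D (1 / 3) Gamma_group S (\<lambda>k. Gamma_cong (5 ^ k)))
    \<and> (\<forall>N \<alpha>. congruence_box N \<and> \<alpha> \<in> {0<..1} \<and> property_D \<alpha> Gamma_group S (\<lambda>k. Gamma_cong (N k))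
          \<longrightarrow> \<alpha> \<le> 1 / 3)
    \<and> (\<exists>N. congruence_box N \<and>
          (\<forall>\<alpha>\<in>{0<..1}. \<not> property_D \<alpha> Gamma_group S (\<lambda>k. Gamma_cong (N k))))"
proof (intro conjI)
  show "congruence_box (\<lambda>k. 5 ^ k)" by (simp add: congruence_box_iff)
  show "property_D (1 / 3) Gamma_group S (\<lambda>k. Gamma_cong (5 ^ k))"
    by (rule property_D_five_powers[OF assms])
  show "\<forall>N \<alpha>. congruence_box N \<and> \<alpha> \<in> {0<..1} \<and> property_D \<alpha> Gamma_group S (\<lambda>k. Gamma_cong (N k))
      \<longrightarrow> \<alpha> \<le> 1 / 3"
    using property_D_exponent_le[OF assms(2)] by blast
  show "\<exists>N. congruence_box N \<and>
      (\<forall>\<alpha>\<in>{0<..1}. \<not> property_D \<alpha> Gamma_group S (\<lambda>k. Gamma_cong (N k)))"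
    by (intro exI[of _ "\<lambda>k. fib (2 ^ Suc k)"] conjI ballI congruence_box_fib
        not_property_D_fib assms(2)) simp
qed

end
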